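(* Let $0<\varepsilon<\infty$, $0<s<\infty$ and $0<\ell<\infty$. Let $V_1,V_2,\ldots$ and $W_1,W_2,\ldots$ be two independent sequences of independent standard Gaussian random variables, and define $X_0=0$, $X_t=\sum_{i=1}^t V_i+st$ and $Y_0=0$, $Y_t=X_t+\varepsilon\sum_{i=1}^t W_i$ for integers $t\ge 1$. Let $\tau_\ell=\inf\{t\ge 0: X_t\ge \ell\}$. Then for any integer $n$ such that $1\le n<\ell/s$, $$ \inf_{\eta(Y_0^{\infty})}\mathbb{E}|\eta-\tau_\ell| \geq \sqrt{\frac{2n\varepsilon^2}{\pi s^2(1+\varepsilon^2)}}-\left(\frac{2n}{\pi^3s^6}\right)^{1/4}-\sqrt{\frac{2(\ell-sn)_+}{\pi s^3}}-2-\frac{6}{s}-\left(2n^{3/2}+\frac{n}{s}+\frac{n^{1/2}\ell}{s}\right)Q\!\left(\frac{\ell-sn}{\sqrt{n}}\right)^{1/2}, $$ where the infimum is over all estimators $\eta=\eta(Y_0^\infty)$, i.e. all (measurable) functions of the entire observation sequence $Y_0^\infty=(Y_0,Y_1,Y_2,\ldots)$, not necessarily stopping times.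
   Context: Standard Gaussian means mean zero and unit variance. Notation: $x_+=\max\{0,x\}$ and $Q(x)=\frac{1}{\sqrt{2\pi}}\int_x^\infty \exp(-u^2/2)\,du$; $Q(x)^{1/2}$ is the square root of $Q(x)$. *)

theory Defs
  imports "HOL-Probability.Probability"
begin

definition gaussian_Q :: "real \<Rightarrow> real" where
  "gaussian_Q x = 1 / sqrt (2 * pi) * (LINT u:{x..}|lborel. exp (- u\<^sup>2 / 2))"

text \<open>The sums run over \<open>1, \<dots>, t\<close>; the values \<open>V 0\<close> and \<open>W 0\<close> are never used.\<close>

definition drift_walk :: "real \<Rightarrow> (nat \<Rightarrow> 'a \<Rightarrow> real) \<Rightarrow> nat \<Rightarrow> 'a \<Rightarrow> real" where
  "drift_walk s V t \<omega> = (\<Sum>i=1..t. V i \<omega>) + s * real t"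

definition noisy_walk ::
  "real \<Rightarrow> real \<Rightarrow> (nat \<Rightarrow> 'a \<Rightarrow> real) \<Rightarrow> (nat \<Rightarrow> 'a \<Rightarrow> real) \<Rightarrow> nat \<Rightarrow> 'a \<Rightarrow> real" where
  "noisy_walk s \<epsilon> V W t \<omega> = drift_walk s V t \<omega> + \<epsilon> * (\<Sum>i=1..t. W i \<omega>)"

text \<open>Extended-real valued: the first-passage time is \<open>\<infinity>\<close> if the level is never reached.\<close>

definition first_passage :: "(nat \<Rightarrow> 'a \<Rightarrow> real) \<Rightarrow> real \<Rightarrow> 'a \<Rightarrow> ereal" where
  "first_passage X l \<omega> = (INF t\<in>{t. X t \<omega> \<ge> l}. ereal (real t))"

text \<open>\<open>\<eta>\<close> is a function of the whole observed path. The expectation is a nonnegative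
  integral, so it is \<open>\<infinity>\<close> (not \<open>0\<close>) when the error is not integrable.\<close>

definition mean_abs_error ::
  "'a measure \<Rightarrow> (nat \<Rightarrow> 'a \<Rightarrow> real) \<Rightarrow> ('a \<Rightarrow> ereal) \<Rightarrow> ((nat \<Rightarrow> real) \<Rightarrow> real) \<Rightarrow> ennreal" where
  "mean_abs_error M Y \<tau> \<eta> = (\<integral>\<^sup>+\<omega>. e2ennreal \<bar>ereal (\<eta> (\<lambda>t. Y t \<omega>)) - \<tau> \<omega>\<bar> \<partial>M)"

definition estimators :: "((nat \<Rightarrow> real) \<Rightarrow> real) set" where
  "estimators = borel_measurable (PiM UNIV (\<lambda>_. borel))"

end

theory Submission
  imports Defs "HOL-Real_Asymp.Real_Asymp"
begin

text \<open>
  Write \<open>\<xi> = n + (l - X n) / s\<close> for the prediction of the passage time \<open>\<tau>\<close> from the position at time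
  \<open>n\<close>; then \<open>E \<bar>\<eta> - \<tau>\<bar> \<ge> E \<bar>\<eta> - \<xi>\<bar> - E \<bar>\<xi> - \<tau>\<bar>\<close>.

  For the first term, reflecting each pair \<open>(V i, W i)\<close> in the line that fixes \<open>V i + \<epsilon> W i\<close> and
  negates \<open>\<epsilon> V i - W i\<close> preserves the joint law and the observations, but moves \<open>\<xi>\<close> by a multiple
  of the Gaussian variable \<open>\<Sum>i\<le>n. \<epsilon> V i - W i\<close>. The errors before and after the reflection add up
  to at least the size of this displacement.

  For the second term, on \<open>\<tau> > n\<close> the walk restarts at distance \<open>h = l - X n > 0\<close> from the level.
  For fixed \<open>h\<close>, Wald's identity and the bound \<open>s + 1\<close> on the mean overshoot control the mean of the
  passage time \<open>T\<close>, while its early part \<open>(m - T)\<^sup>+\<close>, with \<open>m\<close> the integer nearest to \<open>h / s\<close>, is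
  controlled by the positive part of \<open>X m - h\<close>; averaging over \<open>h\<close> uses the concavity of the square
  root. On \<open>\<tau> \<le> n\<close>, a union bound and the Cauchy--Schwarz inequality give the term with \<open>Q\<close>.
\<close>

section \<open>Independence and Gaussian moments\<close>

text \<open>By independence the joint law is a product, so the second variable may be integrated
  over a fresh sample point while the first is held fixed. This is how later arguments condition on
  the past of the walk.\<close>

lemma (in prob_space) indep_var_nn_integral_pair:
  assumes "indep_var S X T Y" and f: "f \<in> borel_measurable (S \<Otimes>\<^sub>M T)"
  shows "(\<integral>\<^sup>+\<omega>. f (X \<omega>, Y \<omega>) \<partial>M) = (\<integral>\<^sup>+\<omega>. (\<integral>\<^sup>+\<omega>'. f (X \<omega>, Y \<omega>') \<partial>M) \<partial>M)"
proof -
  have [measurable]: "X \<in> M \<rightarrow>\<^sub>M S" "Y \<in> M \<rightarrow>\<^sub>M T"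
    and eq: "distr M S X \<Otimes>\<^sub>M distr M T Y = distr M (S \<Otimes>\<^sub>M T) (\<lambda>x. (X x, Y x))"
    using assms(1) unfolding indep_var_distribution_eq by auto
  note f[measurable]
  interpret Y: prob_space "distr M T Y" by (rule prob_space_distr) simp
  have "(\<integral>\<^sup>+\<omega>. f (X \<omega>, Y \<omega>) \<partial>M) = (\<integral>\<^sup>+z. f z \<partial>distr M (S \<Otimes>\<^sub>M T) (\<lambda>x. (X x, Y x)))"
    by (simp add: nn_integral_distr)
  also have "\<dots> = (\<integral>\<^sup>+x. (\<integral>\<^sup>+y. f (x, y) \<partial>distr M T Y) \<partial>distr M S X)"
    unfolding eq[symmetric] by (subst Y.nn_integral_fst) simp_all
  also have "\<dots> = (\<integral>\<^sup>+\<omega>. (\<integral>\<^sup>+y. f (X \<omega>, y) \<partial>distr M T Y) \<partial>M)"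
    by (subst nn_integral_distr) (auto intro!: Y.borel_measurable_nn_integral)
  also have "\<dots> = (\<integral>\<^sup>+\<omega>. (\<integral>\<^sup>+\<omega>'. f (X \<omega>, Y \<omega>') \<partial>M) \<partial>M)"
    by (intro nn_integral_cong nn_integral_distr) (auto intro!: measurable_Pair2[OF f] measurable_space[of X M S])
  finally show ?thesis .
qed

section \<open>Gaussian jumps over a level\<close>

text \<open>The density phi satisfies phi'(v) = - v phi(v), so v phi(v) integrates to phi(a) over
  \<open>{a..}\<close>, while the tail is at least phi(a) / (a + 1). Hence that integral is at most
  a + 1 times the tail, and taking away a times the tail leaves the claim.\<close>

lemma std_normal_tail_bound:
  assumes "0 \<le> a"
  shows "(\<integral>\<^sup>+v. ennreal (std_normal_density v * (v - a)) * indicator {a..} v \<partial>lborel)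
    \<le> (\<integral>\<^sup>+v. ennreal (std_normal_density v) * indicator {a..} v \<partial>lborel)"
proof -
  let ?\<phi> = std_normal_density
  have lim: "(?\<phi> \<longlongrightarrow> 0) at_top"
    unfolding std_normal_density_def by real_asymp
  have lim': "((\<lambda>v. ?\<phi> v / (v + 1)) \<longlongrightarrow> 0) at_top"
    unfolding std_normal_density_def by real_asymp
  have d: "(?\<phi> has_real_derivative - (v * ?\<phi> v)) (at v)" for v
    unfolding std_normal_density_def
    by (auto intro!: derivative_eq_intros simp: real_div_sqrt field_simps)
  have d': "((\<lambda>v. - (?\<phi> v / (v + 1))) has_real_derivative ?\<phi> v * (v / (v + 1) + 1 / (v + 1)\<^sup>2)) (at v)"
    if "0 \<le> v" for v
    using that
    by (auto intro!: derivative_eq_intros d simp: divide_simps power2_eq_square) (simp add: algebra_simps)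
  have A: "(\<integral>\<^sup>+v. ennreal (?\<phi> v * v) * indicator {a..} v \<partial>lborel) = ennreal (0 - - ?\<phi> a)"
    using assms
    by (intro nn_integral_FTC_atLeast)
       (auto intro!: derivative_eq_intros d tendsto_eq_intros lim)
  \<comment> \<open>\<open>v / (v + 1) + 1 / (v + 1)\<^sup>2 \<le> 1\<close>, so \<open>B\<close> bounds the Gaussian tail from below (Mills' ratio).\<close>
  have B: "(\<integral>\<^sup>+v. ennreal (?\<phi> v * (v / (v + 1) + 1 / (v + 1)\<^sup>2)) * indicator {a..} v \<partial>lborel)
      = ennreal (0 - - (?\<phi> a / (a + 1)))"
    using assms
    by (intro nn_integral_FTC_atLeast) (use tendsto_minus[OF lim'] in \<open>auto intro!: d'\<close>)
  have B': "ennreal (?\<phi> a / (a + 1)) \<le> (\<integral>\<^sup>+v. ennreal (?\<phi> v) * indicator {a..} v \<partial>lborel)"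
  proof -
    have "?\<phi> v * (v / (v + 1) + 1 / (v + 1)\<^sup>2) \<le> ?\<phi> v * 1" if "a \<le> v" for v
    proof (rule mult_left_mono)
      have "0 \<le> v"
        using assms that by simp
      then have "1 / (v + 1)\<^sup>2 \<le> 1 / (v + 1)" "v / (v + 1) = 1 - 1 / (v + 1)"
        by (auto intro!: divide_left_mono self_le_power simp: field_simps)
      then show "v / (v + 1) + 1 / (v + 1)\<^sup>2 \<le> 1"
        by simp
    qed simp
    then show ?thesis
      unfolding B[simplified, symmetric]
      by (intro nn_integral_mono) (auto split: split_indicator intro!: ennreal_leI)
  qed
  \<comment> \<open>Finiteness of the tail allows the common summand, \<open>a\<close> times the
    tail, to be cancelled in \<open>ennreal\<close> at the end.\<close>
  have fin: "(\<integral>\<^sup>+v. ennreal (?\<phi> v) * indicator {a..} v \<partial>lborel) < \<infinity>"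
  proof -
    have "(\<integral>\<^sup>+v. ennreal (?\<phi> v) * indicator {a..} v \<partial>lborel) \<le> (\<integral>\<^sup>+v. ennreal (?\<phi> v) \<partial>lborel)"
      by (intro nn_integral_mono) (auto split: split_indicator)
    also have "\<dots> = 1"
      by (subst nn_integral_eq_integral) auto
    finally show ?thesis
      using le_less_trans by fastforce
  qed
  have split: "(\<integral>\<^sup>+v. ennreal (?\<phi> v * (v - a)) * indicator {a..} v \<partial>lborel)
      + ennreal a * (\<integral>\<^sup>+v. ennreal (?\<phi> v) * indicator {a..} v \<partial>lborel)
      = (\<integral>\<^sup>+v. ennreal (?\<phi> v * v) * indicator {a..} v \<partial>lborel)"
  proof -
    have "ennreal (?\<phi> v * (v - a)) + ennreal a * ennreal (?\<phi> v) = ennreal (?\<phi> v * v)"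
      if "a \<le> v" for v
    proof -
      have "ennreal (?\<phi> v * (v - a)) + ennreal a * ennreal (?\<phi> v)
          = ennreal (?\<phi> v * (v - a) + a * ?\<phi> v)"
        using assms that by (subst ennreal_plus) (auto simp: ennreal_mult')
      then show ?thesis
        by (simp add: algebra_simps)
    qed
    then show ?thesis
      by (subst nn_integral_cmult[symmetric], simp, subst nn_integral_add[symmetric], simp, simp,
          intro nn_integral_cong) (auto split: split_indicator)
  qed
  also have "\<dots> = ennreal (a + 1) * ennreal (?\<phi> a / (a + 1))"
    using assms unfolding A by (subst ennreal_mult'[symmetric]) auto
  also have "\<dots> \<le> ennreal (a + 1) * (\<integral>\<^sup>+v. ennreal (?\<phi> v) * indicator {a..} v \<partial>lborel)"
    by (intro mult_left_mono B') simp
  also have "\<dots> = (\<integral>\<^sup>+v. ennreal (?\<phi> v) * indicator {a..} v \<partial>lborel)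
      + ennreal a * (\<integral>\<^sup>+v. ennreal (?\<phi> v) * indicator {a..} v \<partial>lborel)"
    using assms by (simp add: ennreal_plus algebra_simps)
  finally show ?thesis
    using fin
    by (subst (asm) (1 2) add.commute) (auto simp: ennreal_add_left_cancel_le ennreal_mult_eq_top_iff)
qed

text \<open>Given that one step covers the remaining distance \<open>b\<close>, its mean excess is
  at most \<open>s + 1\<close>, uniformly in \<open>b\<close>. This uniformity later makes the mean
  overshoot of the walk independent of the level.\<close>

lemma (in prob_space) std_normal_overshoot:
  assumes U: "distributed M lborel U std_normal_density" and "0 \<le> s" "0 < b"
  shows "(\<integral>\<^sup>+\<omega>. ennreal (max 0 (U \<omega> + s - b)) \<partial>M)
    \<le> (\<integral>\<^sup>+\<omega>. ennreal (s + 1) * indicator {b..} (U \<omega> + s) \<partial>M)"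
proof -
  let ?\<phi> = std_normal_density
  define a where "a = b - s"
  \<comment> \<open>The threshold \<open>a\<close> for the centred step is negative when
    \<open>b < s\<close>, and there the tail bound does not apply. Raising it to \<open>a'\<close>
    costs at most \<open>s\<close> on \<open>{a..}\<close>, because
    \<open>a' - a \<le> s\<close>.\<close>
  define a' where "a' = max 0 a"
  have a: "- s \<le> a" "0 \<le> a'" "a \<le> a'" "a' \<le> a + s"
    using assms by (auto simp: a_def a'_def)
  let ?I = "\<lambda>A. (\<integral>\<^sup>+v. ennreal (?\<phi> v) * indicator A v \<partial>lborel)"
  have "(\<integral>\<^sup>+\<omega>. ennreal (max 0 (U \<omega> + s - b)) \<partial>M) = (\<integral>\<^sup>+v. ennreal (?\<phi> v) * ennreal (max 0 (v + s - b)) \<partial>lborel)"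
    by (subst distributed_nn_integral[OF U]) auto
  also have "\<dots> \<le> (\<integral>\<^sup>+v. ennreal s * (ennreal (?\<phi> v) * indicator {a..} v)
      + ennreal (?\<phi> v * (v - a')) * indicator {a'..} v \<partial>lborel)"
  proof (rule nn_integral_mono)
    fix v
    have "?\<phi> v * max 0 (v + s - b)
        \<le> s * (?\<phi> v * indicator {a..} v) + ?\<phi> v * (v - a') * indicator {a'..} v"
    proof -
      have "max 0 (v + s - b) \<le> s * indicator {a..} v + (v - a') * indicator {a'..} v"
        using a assms by (auto simp: a_def a'_def split: split_indicator)
      from mult_left_mono[OF this, of "?\<phi> v"] show ?thesis
        by (simp add: algebra_simps)
    qed
    then have "ennreal (?\<phi> v * max 0 (v + s - b))
        \<le> ennreal (s * (?\<phi> v * indicator {a..} v) + ?\<phi> v * (v - a') * indicator {a'..} v)"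
      by (rule ennreal_leI)
    also have "\<dots> = ennreal s * (ennreal (?\<phi> v) * indicator {a..} v)
        + ennreal (?\<phi> v * (v - a')) * indicator {a'..} v"
      using assms by (auto split: split_indicator simp: ennreal_mult')
    finally show "ennreal (?\<phi> v) * ennreal (max 0 (v + s - b))
        \<le> ennreal s * (ennreal (?\<phi> v) * indicator {a..} v)
          + ennreal (?\<phi> v * (v - a')) * indicator {a'..} v"
      by (subst ennreal_mult'[symmetric]) simp_all
  qed
  also have "\<dots> = ennreal s * ?I {a..} + (\<integral>\<^sup>+v. ennreal (?\<phi> v * (v - a')) * indicator {a'..} v \<partial>lborel)"
    by (simp add: nn_integral_add nn_integral_cmult)
  also have "\<dots> \<le> ennreal s * ?I {a..} + ?I {a'..}"
    using a by (intro add_left_mono std_normal_tail_bound)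
  also have "\<dots> \<le> ennreal s * ?I {a..} + ?I {a..}"
    using a by (intro add_left_mono nn_integral_mono) (auto split: split_indicator)
  also have "\<dots> = ennreal (s + 1) * ?I {a..}"
    using assms by (simp add: ennreal_plus algebra_simps)
  also have "\<dots> = (\<integral>\<^sup>+v. ennreal (?\<phi> v) * (ennreal (s + 1) * indicator {a..} v) \<partial>lborel)"
    by (subst nn_integral_cmult[symmetric]) (auto simp: ac_simps)
  also have "\<dots> = (\<integral>\<^sup>+\<omega>. ennreal (s + 1) * indicator {a..} (U \<omega>) \<partial>M)"
    by (subst distributed_nn_integral[OF U]) auto
  also have "\<dots> = (\<integral>\<^sup>+\<omega>. ennreal (s + 1) * indicator {b..} (U \<omega> + s) \<partial>M)"
    by (intro nn_integral_cong) (auto split: split_indicator simp: a_def)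
  finally show ?thesis .
qed

section \<open>Moments and inequalities for expectations\<close>

lemma (in prob_space) normal_moments:
  assumes D: "distributed M lborel Z (normal_density 0 \<sigma>)" and "0 < \<sigma>"
  shows "integrable M Z" "expectation Z = 0" "expectation (\<lambda>\<omega>. \<bar>Z \<omega>\<bar>) = \<sigma> * sqrt (2 / pi)"
    "integrable M (\<lambda>\<omega>. (Z \<omega>)\<^sup>2)" "expectation (\<lambda>\<omega>. (Z \<omega>)\<^sup>2) = \<sigma>\<^sup>2"
proof -
  show "integrable M Z"
    using distributed_integrable[OF D, of "\<lambda>x. x"] integrable_normal_moment_nz_1[OF assms(2), of 0]
    by auto
  show "expectation Z = 0"
    by (rule normal_distributed_expectation[OF assms(2) D])
  show "expectation (\<lambda>\<omega>. \<bar>Z \<omega>\<bar>) = \<sigma> * sqrt (2 / pi)"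
    using distributed_integral[OF D, of "\<lambda>x. \<bar>x\<bar>"] integral_normal_moment_abs_odd[OF assms(2), of 0 0]
    by auto
  show "integrable M (\<lambda>\<omega>. (Z \<omega>)\<^sup>2)"
    using distributed_integrable[OF D, of "\<lambda>x. x\<^sup>2"] integrable_normal_moment[OF assms(2), of 0 2]
    by auto
  show "expectation (\<lambda>\<omega>. (Z \<omega>)\<^sup>2) = \<sigma>\<^sup>2"
    using distributed_integral[OF D, of "\<lambda>x. x\<^sup>2"] integral_normal_moment_even[OF assms(2), of 0 1]
    by (simp add: fact_numeral)
qed

text \<open>The positive part is subadditive, and that of \<open>Z\<close> is half of
  \<open>Z + \<bar>Z\<bar>\<close>, whose mean is half the mean of \<open>\<bar>Z\<bar>\<close> for
  a centred variable.\<close>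

lemma (in prob_space) expectation_positive_part_le:
  fixes Z :: "'a \<Rightarrow> real"
  assumes Z: "integrable M Z" "expectation Z = 0"
  shows "expectation (\<lambda>\<omega>. max 0 (c + Z \<omega>)) \<le> max 0 c + expectation (\<lambda>\<omega>. \<bar>Z \<omega>\<bar>) / 2"
proof -
  have "expectation (\<lambda>\<omega>. max 0 (c + Z \<omega>)) \<le> expectation (\<lambda>\<omega>. max 0 c + (Z \<omega> + \<bar>Z \<omega>\<bar>) / 2)"
  proof (rule integral_mono)
    show "max 0 (c + Z \<omega>) \<le> max 0 c + (Z \<omega> + \<bar>Z \<omega>\<bar>) / 2" for \<omega>
      by (auto simp: max_def abs_if field_simps)
  qed (use Z(1) in auto)
  also have "\<dots> = max 0 c + expectation (\<lambda>\<omega>. \<bar>Z \<omega>\<bar>) / 2"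
    using Z by (simp add: prob_space)
  finally show ?thesis .
qed

text \<open>Jensen's inequality for the square root, read off from the nonnegativity of the variance
  of \<open>sqrt Z\<close>. Integrability comes from \<open>sqrt z \<le> 1 + z\<close>.\<close>

lemma (in prob_space) expectation_sqrt_le:
  fixes Z :: "'a \<Rightarrow> real"
  assumes Z: "integrable M Z" and nn: "\<And>\<omega>. 0 \<le> Z \<omega>"
  shows "integrable M (\<lambda>\<omega>. sqrt (Z \<omega>))" "expectation (\<lambda>\<omega>. sqrt (Z \<omega>)) \<le> sqrt (expectation Z)"
proof -
  have [measurable]: "Z \<in> borel_measurable M"
    using Z by simp
  have bound: "sqrt z \<le> 1 + z" if "0 \<le> z" for z :: real
  proof (rule real_le_lsqrt)
    show "z \<le> (1 + z)\<^sup>2"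
      using that zero_le_power2[of z] by (simp add: power2_sum)
  qed (use that in auto)
  show int: "integrable M (\<lambda>\<omega>. sqrt (Z \<omega>))"
  proof (rule Bochner_Integration.integrable_bound)
    show "integrable M (\<lambda>\<omega>. 1 + Z \<omega>)"
      using Z by simp
    show "AE \<omega> in M. norm (sqrt (Z \<omega>)) \<le> norm (1 + Z \<omega>)"
      using bound[OF nn] nn by (intro AE_I2) (simp add: abs_of_nonneg add_nonneg_nonneg)
  qed simp
  have "0 \<le> variance (\<lambda>\<omega>. sqrt (Z \<omega>))"
    by (rule variance_positive)
  also have "\<dots> = expectation Z - (expectation (\<lambda>\<omega>. sqrt (Z \<omega>)))\<^sup>2"
    using Z by (subst variance_eq[OF int]) (simp_all add: nn)
  finally show "expectation (\<lambda>\<omega>. sqrt (Z \<omega>)) \<le> sqrt (expectation Z)"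
    by (intro real_le_rsqrt) simp
qed

text \<open>Cauchy--Schwarz with the indicator of \<open>A\<close>, which is its own square, as the
  second factor.\<close>

lemma (in prob_space) expectation_abs_indicator_le:
  fixes Z :: "'a \<Rightarrow> real"
  assumes Z[measurable]: "Z \<in> borel_measurable M" and int: "integrable M (\<lambda>\<omega>. (Z \<omega>)\<^sup>2)"
    and A[measurable]: "A \<in> events"
  shows "(\<integral>\<^sup>+\<omega>. ennreal \<bar>Z \<omega>\<bar> * indicator A \<omega> \<partial>M) \<le> ennreal (sqrt (expectation (\<lambda>\<omega>. (Z \<omega>)\<^sup>2) * prob A))"
proof -
  let ?I = "\<integral>\<^sup>+\<omega>. ennreal \<bar>Z \<omega>\<bar> * indicator A \<omega> \<partial>M"
  let ?E = "expectation (\<lambda>\<omega>. (Z \<omega>)\<^sup>2) * prob A"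
  have E: "0 \<le> ?E"
    by (auto intro!: mult_nonneg_nonneg integral_nonneg)
  have "?I\<^sup>2 \<le> (\<integral>\<^sup>+\<omega>. (ennreal \<bar>Z \<omega>\<bar>)\<^sup>2 \<partial>M) * (\<integral>\<^sup>+\<omega>. (indicator A \<omega>)\<^sup>2 \<partial>M)"
    by (rule Cauchy_Schwarz_nn_integral) auto
  also have "(\<integral>\<^sup>+\<omega>. (ennreal \<bar>Z \<omega>\<bar>)\<^sup>2 \<partial>M) = ennreal (expectation (\<lambda>\<omega>. (Z \<omega>)\<^sup>2))"
    by (simp add: ennreal_power nn_integral_eq_integral[OF int])
  also have "(\<integral>\<^sup>+\<omega>. (indicator A \<omega>)\<^sup>2 \<partial>M) = ennreal (prob A)"
  proof -
    have "(indicator A \<omega>)\<^sup>2 = (indicator A \<omega> :: ennreal)" for \<omega>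
      by (simp add: indicator_def)
    then show ?thesis
      by (simp add: emeasure_eq_measure)
  qed
  also have "ennreal (expectation (\<lambda>\<omega>. (Z \<omega>)\<^sup>2)) * ennreal (prob A) = (ennreal (sqrt ?E))\<^sup>2"
    using E by (simp add: ennreal_power ennreal_mult')
  finally have le: "?I\<^sup>2 \<le> (ennreal (sqrt ?E))\<^sup>2" .
  show ?thesis
  \<comment> \<open>The square root is taken in the reals; an infinite integral would contradict the
    finite bound on its square.\<close>
  proof (cases ?I)
    case (real r)
    define e where "e = sqrt ?E"
    have e: "0 \<le> e"
      using E by (simp add: e_def)
    have "ennreal (r\<^sup>2) \<le> ennreal (e\<^sup>2)"
      using le real e unfolding e_def[symmetric] by (simp add: ennreal_power)
    then have "r \<le> e"
      using e by (intro power2_le_imp_le[of r e]) simp_all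
    then show ?thesis
      using real unfolding e_def[symmetric] by (simp add: ennreal_leI)
  next
    case top
    then show ?thesis
      using le E by (simp add: ennreal_power top_unique del: real_sqrt_pow2)
  qed
qed

section \<open>The function Q as a Gaussian tail probability\<close>

lemma gaussian_Q_eq: "gaussian_Q x = measure (density lborel std_normal_density) {x..}"
proof -
  have "ennreal (measure (density lborel std_normal_density) {x..}) = (\<integral>\<^sup>+u. ennreal (std_normal_density u) * indicator {x..} u \<partial>lborel)"
    by (subst finite_measure.emeasure_eq_measure[symmetric])
       (auto simp: emeasure_density prob_space_normal_density prob_space.finite_measure)
  also have "\<dots> = (\<integral>\<^sup>+u. ennreal (indicator {x..} u * std_normal_density u) \<partial>lborel)"
    by (intro nn_integral_cong) (auto simp: indicator_def)
  also have "\<dots> = ennreal (\<integral>u. indicator {x..} u * std_normal_density u \<partial>lborel)"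
    using integrable_real_mult_indicator[of "{x..}" lborel std_normal_density]
    by (intro nn_integral_eq_integral) (auto simp: mult.commute)
  finally have "measure (density lborel std_normal_density) {x..} = (\<integral>u. indicator {x..} u * std_normal_density u \<partial>lborel)"
    by (subst (asm) ennreal_inj) (auto intro!: integral_nonneg)
  also have "\<dots> = gaussian_Q x"
    unfolding gaussian_Q_def set_lebesgue_integral_def std_normal_density_def
    by (subst integral_mult_right_zero[symmetric]) (auto intro!: Bochner_Integration.integral_cong simp: mult_ac)
  finally show ?thesis ..
qed

lemma gaussian_Q_antimono: "x \<le> y \<Longrightarrow> gaussian_Q y \<le> gaussian_Q x"
  unfolding gaussian_Q_eq
  by (intro finite_measure.finite_measure_mono prob_space.finite_measure prob_space_normal_density) auto

lemma gaussian_Q_nonneg: "0 \<le> gaussian_Q x"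
  unfolding gaussian_Q_eq by simp

lemma (in prob_space) prob_ge_std_normal:
  assumes "distributed M lborel U std_normal_density"
  shows "prob {\<omega> \<in> space M. x \<le> U \<omega>} = gaussian_Q x"
proof -
  have "U \<in> borel_measurable M" and "distr M lborel U = density lborel std_normal_density"
    using assms by (auto simp: distributed_def)
  then show ?thesis
    by (simp add: gaussian_Q_eq flip: \<open>distr M lborel U = _\<close>)
       (subst measure_distr, auto simp: vimage_def Int_def conj_commute)
qed

section \<open>First passage of a Gaussian walk\<close>

text \<open>For the first passage time T of level \<open>h\<close> this is the event T > k. Its
  indicators sum to T over all k and to the minimum of T and m over k < m; the complementary
  indicators over k < m sum to the positive part of m - T. Estimates for T thus become estimates for
  sums of indicators.\<close>

definition stays_below :: "(nat \<Rightarrow> 'a \<Rightarrow> real) \<Rightarrow> real \<Rightarrow> nat \<Rightarrow> 'a set" where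
  "stays_below X h k = {\<omega>. \<forall>j\<le>k. X j \<omega> < h}"

lemma stays_below_Suc:
  "\<omega> \<in> stays_below X h (Suc k) \<longleftrightarrow> \<omega> \<in> stays_below X h k \<and> X (Suc k) \<omega> < h"
  by (auto simp: stays_below_def le_Suc_eq)

lemma pred_stays_below[measurable (raw)]:
  assumes [measurable]: "f \<in> N \<rightarrow>\<^sub>M M" "\<And>j. X j \<in> borel_measurable M"
  shows "Measurable.pred N (\<lambda>x. f x \<in> stays_below X h k)"
  unfolding stays_below_def by simp

lemma borel_measurable_indicator_stays_below[measurable (raw)]:
  fixes X :: "nat \<Rightarrow> 'a \<Rightarrow> real"
  assumes [measurable]: "f \<in> N \<rightarrow>\<^sub>M M" "\<And>j. X j \<in> borel_measurable M"
  shows "(\<lambda>x. indicator (stays_below X h k) (f x) :: real) \<in> borel_measurable N"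
    "(\<lambda>x. indicator (stays_below X h k) (f x) :: ennreal) \<in> borel_measurable N"
  unfolding indicator_def by measurable

lemma first_passage_cases:
  obtains "\<forall>t. X t \<omega> < l" "first_passage X l \<omega> = \<infinity>"
  | t where "l \<le> X t \<omega>" "\<And>j. j < t \<Longrightarrow> X j \<omega> < l" "first_passage X l \<omega> = ereal (real t)"
proof (cases "\<exists>t. l \<le> X t \<omega>")
  case True
  define t where "t = (LEAST t. l \<le> X t \<omega>)"
  have t: "l \<le> X t \<omega>"
    using True unfolding t_def by (auto intro: LeastI)
  have "first_passage X l \<omega> = ereal (real t)"
    unfolding first_passage_def
  proof (rule antisym)
    show "(INF t\<in>{t. l \<le> X t \<omega>}. ereal (real t)) \<le> ereal (real t)"
      using t by (intro INF_lower) auto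
    show "ereal (real t) \<le> (INF t\<in>{t. l \<le> X t \<omega>}. ereal (real t))"
      unfolding t_def by (intro INF_greatest) (auto intro: Least_le)
  qed
  moreover have "X j \<omega> < l" if "j < t" for j
    using not_less_Least[of j "\<lambda>t. l \<le> X t \<omega>"] that unfolding t_def by (simp add: not_le)
  ultimately show thesis
    using t that(2) by blast
next
  case False
  then have "{t. l \<le> X t \<omega>} = {}"
    by auto
  then have "first_passage X l \<omega> = \<infinity>"
    by (simp add: first_passage_def top_ereal_def)
  with False show thesis
    using that(1) by (auto simp: not_le)
qed

text \<open>The level is allowed to be random, because after a restart the remaining distance
  depends on the past. The infimum over a random index set becomes a countable infimum once the
  value infinity is assigned off that set.\<close>

lemma borel_measurable_first_passage:
  assumes [measurable]: "\<And>t. X t \<in> borel_measurable M" "g \<in> borel_measurable M"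
  shows "(\<lambda>\<omega>. first_passage (\<lambda>t \<omega>. X t \<omega>) (g \<omega>) \<omega>) \<in> borel_measurable M"
proof -
  have *: "first_passage X (g \<omega>) \<omega> = (INF t. if g \<omega> \<le> X t \<omega> then ereal (real t) else \<infinity>)" for \<omega>
    unfolding first_passage_def
  proof (rule antisym)
    show "(INF t\<in>{t. g \<omega> \<le> X t \<omega>}. ereal (real t)) \<le> (INF t. if g \<omega> \<le> X t \<omega> then ereal (real t) else \<infinity>)"
      by (intro INF_greatest) (auto intro: INF_lower)
    show "(INF t. if g \<omega> \<le> X t \<omega> then ereal (real t) else \<infinity>) \<le> (INF t\<in>{t. g \<omega> \<le> X t \<omega>}. ereal (real t))"
    proof (rule INF_greatest)
      fix t assume "t \<in> {t. g \<omega> \<le> X t \<omega>}"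
      then show "(INF t. if g \<omega> \<le> X t \<omega> then ereal (real t) else \<infinity>) \<le> ereal (real t)"
        by (intro INF_lower2[of t]) auto
    qed
  qed
  show ?thesis
    unfolding * by measurable
qed

lemma drift_walk_0: "drift_walk s V 0 \<omega> = 0"
  by (simp add: drift_walk_def)

lemma drift_walk_Suc:
  "drift_walk s V (Suc t) \<omega> = drift_walk s V t \<omega> + (V (Suc t) \<omega> + s)"
  by (simp add: drift_walk_def algebra_simps)

lemma drift_walk_measurable[measurable (raw)]:
  assumes "\<And>i. 1 \<le> i \<Longrightarrow> i \<le> t \<Longrightarrow> V i \<in> borel_measurable M"
  shows "drift_walk s V t \<in> borel_measurable M"
  unfolding drift_walk_def[abs_def] using assms by (auto intro!: borel_measurable_sum)

text \<open>With the coordinate maps as steps, the walk becomes a function on path space. In this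
  form independence of blocks of steps can be applied to it.\<close>

lemma drift_walk_restrict:
  assumes "{1..t} \<subseteq> J"
  shows "drift_walk s (\<lambda>i v. v i) t (\<lambda>i\<in>J. V i \<omega>) = drift_walk s V t \<omega>"
  using assms by (auto simp: drift_walk_def intro!: sum.cong)

section \<open>Independence of past and future steps\<close>

locale gaussian_sequence = prob_space M for M :: "'a measure" +
  fixes V :: "nat \<Rightarrow> 'a \<Rightarrow> real"
  assumes std_normal: "\<And>i. 1 \<le> i \<Longrightarrow> distributed M lborel (V i) std_normal_density"
    and indep: "indep_vars (\<lambda>_. borel) V {1..}"
begin

lemma measurable_V: "1 \<le> i \<Longrightarrow> V i \<in> borel_measurable M"
  using std_normal distributed_real_measurable by (auto simp: distributed_def)

lemma measurable_V_Suc[measurable]: "V (Suc i) \<in> borel_measurable M"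
  by (simp add: measurable_V)

lemma measurable_walk[measurable]: "drift_walk s V t \<in> borel_measurable M"
  by (intro drift_walk_measurable measurable_V)

lemma V_moments:
  assumes "1 \<le> i"
  shows "integrable M (V i)" "expectation (V i) = 0"
  using normal_moments[of "V i" 1] std_normal[OF assms] by auto

lemma integrable_walk: "integrable M (drift_walk s V t)"
  unfolding drift_walk_def[abs_def] by (intro Bochner_Integration.integrable_add Bochner_Integration.integrable_sum V_moments) auto

lemma sum_normal:
  assumes "1 \<le> t"
  shows "distributed M lborel (\<lambda>\<omega>. \<Sum>i=1..t. V i \<omega>) (normal_density 0 (sqrt (real t)))"
  using sum_indep_normal[of "{1..t}" V "\<lambda>_. 1" "\<lambda>_. 0"] assms indep_vars_subset[OF indep] std_normal
  by auto

lemma indep_past_future: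
  "indep_var (PiM {1..k} (\<lambda>_. borel)) (\<lambda>\<omega>. \<lambda>i\<in>{1..k}. V i \<omega>)
    (PiM {Suc k..} (\<lambda>_. borel)) (\<lambda>\<omega>. \<lambda>i\<in>{Suc k..}. V i \<omega>)"
  by (rule indep_var_restrict[OF indep]) auto

lemma stays_below_restrict:
  assumes "{1..k} \<subseteq> J"
  shows "(\<lambda>i\<in>J. V i \<omega>) \<in> stays_below (drift_walk s (\<lambda>i v. v i)) h k
    \<longleftrightarrow> \<omega> \<in> stays_below (drift_walk s V) h k"
  using assms by (auto simp: stays_below_def drift_walk_restrict subset_eq)

lemma measurable_coordinate_walk:
  assumes "{1..t} \<subseteq> J"
  shows "drift_walk s (\<lambda>i v. v i) t \<in> borel_measurable (PiM J (\<lambda>_. borel))"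
  by (rule drift_walk_measurable) (use assms in auto)

text \<open>The general measurability rule asks for every position of the walk. On a product over
  \<open>J\<close> only positions up to time \<open>k\<close> are known to be measurable, so the
  event is written as a finite conjunction over these times.\<close>

lemma indicator_coordinate_stays_below:
  assumes "{1..k} \<subseteq> J"
  shows "(indicator (stays_below (drift_walk s (\<lambda>i v. v i)) h k) :: _ \<Rightarrow> real) \<in> borel_measurable (PiM J (\<lambda>_. borel))"
proof -
  have [measurable]: "drift_walk s (\<lambda>i v. v i) j \<in> borel_measurable (PiM J (\<lambda>_. borel))" if "j \<le> k" for j
    using that assms by (intro measurable_coordinate_walk) auto
  have "{v \<in> space (PiM J (\<lambda>_. borel)). \<forall>j\<in>{..k}. drift_walk s (\<lambda>i v. v i) j v < h} \<in> sets (PiM J (\<lambda>_. borel))"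
    by (rule sets.sets_Collect_finite_All') auto
  then show ?thesis
    unfolding borel_measurable_indicator_iff stays_below_def by (simp add: Int_def conj_commute)
qed

text \<open>Whether the level has been reached by time \<open>k\<close> is decided by the first
  \<open>k\<close> steps, hence independent of the centred step \<open>Suc k\<close>.\<close>

lemma step_uncorrelated:
  "integrable M (\<lambda>\<omega>. indicator (stays_below (drift_walk s V) h k) \<omega> * V (Suc k) \<omega>)"
  "expectation (\<lambda>\<omega>. indicator (stays_below (drift_walk s V) h k) \<omega> * V (Suc k) \<omega>) = 0"
proof -
  let ?g = "indicator (stays_below (drift_walk s (\<lambda>i v. v i)) h k) :: _ \<Rightarrow> real"
  have "indep_var borel (?g \<circ> (\<lambda>\<omega>. \<lambda>i\<in>{1..k}. V i \<omega>)) borel ((\<lambda>v. v (Suc k)) \<circ> (\<lambda>\<omega>. \<lambda>i\<in>{Suc k..}. V i \<omega>))"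
    by (rule indep_var_compose[OF indep_past_future]) (auto intro: indicator_coordinate_stays_below)
  moreover have "?g \<circ> (\<lambda>\<omega>. \<lambda>i\<in>{1..k}. V i \<omega>) = indicator (stays_below (drift_walk s V) h k)"
    by (auto simp: fun_eq_iff stays_below_restrict indicator_def)
  ultimately have ind: "indep_var borel (indicator (stays_below (drift_walk s V) h k) :: _ \<Rightarrow> real) borel (V (Suc k))"
    by (simp add: comp_def)
  have int: "integrable M (indicator (stays_below (drift_walk s V) h k) :: _ \<Rightarrow> real)"
    by (rule integrable_const_bound[of _ 1]) (auto simp: indicator_def)
  show "integrable M (\<lambda>\<omega>. indicator (stays_below (drift_walk s V) h k) \<omega> * V (Suc k) \<omega>)"
    using indep_var_integrable[OF ind int V_moments(1)] by simp
  show "expectation (\<lambda>\<omega>. indicator (stays_below (drift_walk s V) h k) \<omega> * V (Suc k) \<omega>) = 0"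
    using indep_var_lebesgue_integral[OF ind int V_moments(1)] V_moments(2)[of "Suc k"] by simp
qed

text \<open>Freezing the first \<open>k\<close> steps turns the remaining distance to the level into
  a positive constant, so the bound for a single step applies and is then averaged over the
  past.\<close>

lemma overshoot:
  assumes "0 \<le> s"
  shows "(\<integral>\<^sup>+\<omega>. ennreal (max 0 (drift_walk s V (Suc k) \<omega> - h)) * indicator (stays_below (drift_walk s V) h k) \<omega> \<partial>M)
    \<le> (\<integral>\<^sup>+\<omega>. ennreal (s + 1) * indicator {h..} (drift_walk s V (Suc k) \<omega>)
          * indicator (stays_below (drift_walk s V) h k) \<omega> \<partial>M)"
proof -
  let ?A = "\<lambda>\<omega>. \<lambda>i\<in>{1..k}. V i \<omega>" and ?B = "\<lambda>\<omega>. \<lambda>i\<in>{Suc k..}. V i \<omega>"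
  let ?X = "drift_walk s (\<lambda>i v. v i) k"
  let ?G = "stays_below (drift_walk s (\<lambda>i v. v i)) h k"
  let ?S = "PiM {1..k} (\<lambda>_. borel) :: (nat \<Rightarrow> real) measure"
  have [measurable]: "?X \<in> borel_measurable ?S" "(indicator ?G :: _ \<Rightarrow> real) \<in> borel_measurable ?S"
    by (auto intro: measurable_coordinate_walk indicator_coordinate_stays_below)
  have fubini: "(\<integral>\<^sup>+\<omega>. f (drift_walk s V (Suc k) \<omega>) * indicator (stays_below (drift_walk s V) h k) \<omega> \<partial>M)
      = (\<integral>\<^sup>+\<omega>. (\<integral>\<^sup>+\<omega>'. f (drift_walk s V k \<omega> + (V (Suc k) \<omega>' + s)) \<partial>M)
          * indicator (stays_below (drift_walk s V) h k) \<omega> \<partial>M)"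
    if [measurable]: "f \<in> borel_measurable borel" for f
  proof -
    have "(\<integral>\<^sup>+\<omega>. f (drift_walk s V (Suc k) \<omega>) * indicator (stays_below (drift_walk s V) h k) \<omega> \<partial>M)
      = (\<integral>\<^sup>+\<omega>. (\<lambda>(a, b). f (?X a + (b (Suc k) + s)) * ennreal (indicator ?G a)) (?A \<omega>, ?B \<omega>) \<partial>M)"
      by (intro nn_integral_cong)
         (auto simp: drift_walk_restrict drift_walk_Suc indicator_def stays_below_restrict)
    also have "\<dots> = (\<integral>\<^sup>+\<omega>. (\<integral>\<^sup>+\<omega>'. (\<lambda>(a, b). f (?X a + (b (Suc k) + s)) * ennreal (indicator ?G a)) (?A \<omega>, ?B \<omega>') \<partial>M) \<partial>M)"
      by (rule indep_var_nn_integral_pair[OF indep_past_future]) measurable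
    also have "\<dots> = (\<integral>\<^sup>+\<omega>. (\<integral>\<^sup>+\<omega>'. f (drift_walk s V k \<omega> + (V (Suc k) \<omega>' + s)) \<partial>M)
          * indicator (stays_below (drift_walk s V) h k) \<omega> \<partial>M)"
      by (intro nn_integral_cong)
         (auto simp: drift_walk_restrict indicator_def stays_below_restrict nn_integral_multc)
    finally show ?thesis .
  qed
  have meas: "(\<lambda>x. ennreal (max 0 (x - h))) \<in> borel_measurable borel"
    "(\<lambda>x. ennreal (s + 1) * indicator {h..} x) \<in> borel_measurable borel"
    by measurable
  show ?thesis
    unfolding fubini[OF meas(1)] fubini[OF meas(2)]
  proof (intro nn_integral_mono)
    fix \<omega>
    show "(\<integral>\<^sup>+\<omega>'. ennreal (max 0 (drift_walk s V k \<omega> + (V (Suc k) \<omega>' + s) - h)) \<partial>M) * indicator (stays_below (drift_walk s V) h k) \<omega>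
      \<le> (\<integral>\<^sup>+\<omega>'. ennreal (s + 1) * indicator {h..} (drift_walk s V k \<omega> + (V (Suc k) \<omega>' + s)) \<partial>M) * indicator (stays_below (drift_walk s V) h k) \<omega>"
    proof (cases "\<omega> \<in> stays_below (drift_walk s V) h k")
      case True
      define b where "b = h - drift_walk s V k \<omega>"
      have "0 < b"
        using True by (auto simp: b_def stays_below_def)
      from std_normal_overshoot[OF std_normal assms this, of "Suc k"]
      have "(\<integral>\<^sup>+\<omega>'. ennreal (max 0 (V (Suc k) \<omega>' + s - b)) \<partial>M) \<le> (\<integral>\<^sup>+\<omega>'. ennreal (s + 1) * indicator {b..} (V (Suc k) \<omega>' + s) \<partial>M)"
        by simp
      then show ?thesis
        using True by (simp add: b_def indicator_def algebra_simps)
    qed simp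
  qed
qed


section \<open>Wald's identity and the mean passage time\<close>

text \<open>The sum on the left is the walk stopped at the passage time or at \<open>m\<close>,
  whichever comes first. It is below \<open>h\<close> before passage and equals \<open>h\<close>
  plus the overshoot afterwards; the term for \<open>k\<close> on the right vanishes unless step
  \<open>Suc k\<close> is the crossing one. The two claims feed each other in the induction.\<close>

lemma stopped_walk_le:
  fixes s h :: real and \<omega> :: 'a
  defines "X \<equiv> drift_walk s V"
  defines "g \<equiv> \<lambda>k. indicator (stays_below X h k) \<omega> :: real"
  assumes "0 < h"
  shows "(\<Sum>k<m. g k * (V (Suc k) \<omega> + s)) \<le> h + (\<Sum>k<m. max 0 (X (Suc k) \<omega> - h) * g k)"
    and "\<omega> \<in> stays_below X h m \<Longrightarrow> (\<Sum>k<m. g k * (V (Suc k) \<omega> + s)) = X m \<omega>"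
proof (induction m)
  case 0
  { case 1 then show ?case using assms by simp
  next case 2 then show ?case by (simp add: X_def drift_walk_0) }
next
  case (Suc m)
  have nn: "0 \<le> (\<Sum>k<m. max 0 (X (Suc k) \<omega> - h) * g k)"
    by (intro sum_nonneg) (simp add: g_def)
  have X: "X (Suc m) \<omega> = X m \<omega> + (V (Suc m) \<omega> + s)"
    by (simp add: X_def drift_walk_Suc)
  { case 1
    show ?case
      using Suc nn X by (cases "\<omega> \<in> stays_below X h m") (auto simp: g_def)
  next
    case 2
    then show ?case
      using Suc(2) X by (auto simp: g_def stays_below_Suc) }
qed

text \<open>First crossings at different steps are disjoint events. The additional event of no
  crossing up to \<open>m\<close> makes the induction go through.\<close>

lemma sum_crossings_le_1:
  "(\<Sum>k<m. indicator {h..} (X (Suc k) \<omega>) * indicator (stays_below X h k) \<omega>)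
    + indicator (stays_below X h m) \<omega> \<le> (1 :: real)"
proof (induction m)
  case (Suc m)
  then show ?case
    by (auto simp: stays_below_Suc indicator_def split: if_splits)
qed (simp add: indicator_def)

text \<open>The sum collects the increments between the passage time T and \<open>m\<close>. If T is
  at most \<open>m\<close>, it equals X m - X T, and X T is at least \<open>h\<close>; otherwise it
  is empty.\<close>

lemma early_passage_le:
  fixes s h :: real and \<omega> :: 'a
  defines "X \<equiv> drift_walk s V"
  defines "g \<equiv> \<lambda>k. indicator (stays_below X h k) \<omega> :: real"
  shows "(\<Sum>k<m. (1 - g k) * (V (Suc k) \<omega> + s)) \<le> max 0 (X m \<omega> - h)"
proof -
  \<comment> \<open>The induction needs the exact value 0 before passage: the bound by
    \<open>X m - h\<close> starts to hold at the crossing step, whose own increment is not yet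
    counted.\<close>
  have "if \<omega> \<in> stays_below X h m then (\<Sum>k<m. (1 - g k) * (V (Suc k) \<omega> + s)) = 0
    else (\<Sum>k<m. (1 - g k) * (V (Suc k) \<omega> + s)) \<le> X m \<omega> - h"
  proof (induction m)
    case 0
    then show ?case
      by (auto simp: stays_below_def)
  next
    case (Suc m)
    have X: "X (Suc m) \<omega> = X m \<omega> + (V (Suc m) \<omega> + s)"
      by (simp add: X_def drift_walk_Suc)
    show ?case
      using Suc X by (auto simp: g_def stays_below_Suc split: if_splits)
  qed
  then show ?thesis
    by (auto split: if_splits)
qed

text \<open>Wald's identity for the passage time truncated at \<open>m\<close>: the noise in each
  counted step has mean zero by \<open>step_uncorrelated\<close>, so only the drift survives.
  Truncation keeps all sums finite.\<close>

lemma wald_identity: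
  fixes s h :: real
  defines "G \<equiv> \<lambda>k. indicator (stays_below (drift_walk s V) h k) :: 'a \<Rightarrow> real"
  shows "integrable M (\<lambda>\<omega>. \<Sum>k<m. G k \<omega> * (V (Suc k) \<omega> + s))"
    and "expectation (\<lambda>\<omega>. \<Sum>k<m. G k \<omega> * (V (Suc k) \<omega> + s)) = s * (\<Sum>k<m. expectation (G k))"
proof -
  have int: "integrable M (G k)" for k
    unfolding G_def by (rule integrable_const_bound[of _ 1]) (auto simp: indicator_def)
  have eq: "(\<lambda>\<omega>. \<Sum>k<m. G k \<omega> * (V (Suc k) \<omega> + s)) = (\<lambda>\<omega>. \<Sum>k<m. G k \<omega> * V (Suc k) \<omega> + s * G k \<omega>)"
    by (simp add: algebra_simps)
  have U: "integrable M (\<lambda>\<omega>. G k \<omega> * V (Suc k) \<omega>)" "expectation (\<lambda>\<omega>. G k \<omega> * V (Suc k) \<omega>) = 0" for k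
    unfolding G_def by (rule step_uncorrelated)+
  show "integrable M (\<lambda>\<omega>. \<Sum>k<m. G k \<omega> * (V (Suc k) \<omega> + s))"
    unfolding eq using U int
    by (intro Bochner_Integration.integrable_sum Bochner_Integration.integrable_add) auto
  show "expectation (\<lambda>\<omega>. \<Sum>k<m. G k \<omega> * (V (Suc k) \<omega> + s)) = s * (\<Sum>k<m. expectation (G k))"
    unfolding eq using U int by (subst Bochner_Integration.integral_sum) (auto simp: sum_distrib_left)
qed

text \<open>By Wald's identity the left side is the mean of the stopped walk, at most
  \<open>h\<close> plus the mean overshoot. Each overshoot term costs at most \<open>s + 1\<close>
  times its crossing probability, and these probabilities sum to at most 1. The bound does not
  depend on \<open>m\<close>.\<close>

lemma expected_passage_time_le:
  assumes "0 < s" "0 < h"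
  shows "s * (\<Sum>k<m. expectation (indicator (stays_below (drift_walk s V) h k))) \<le> h + s + 1"
proof -
  let ?X = "drift_walk s V"
  let ?G = "\<lambda>k. indicator (stays_below ?X h k) :: 'a \<Rightarrow> real"
  let ?O = "\<lambda>k \<omega>. max 0 (?X (Suc k) \<omega> - h) * ?G k \<omega>"
  let ?C = "\<lambda>k \<omega>. (s + 1) * (indicator {h..} (?X (Suc k) \<omega>) * ?G k \<omega>)"
  have intO: "integrable M (?O k)" for k
    by (rule Bochner_Integration.integrable_bound[of _ "\<lambda>\<omega>. ?X (Suc k) \<omega> - h"])
       (auto simp: indicator_def integrable_walk)
  have intC: "integrable M (?C k)" for k
    by (rule integrable_const_bound[of _ "s + 1"]) (use assms in \<open>auto simp: indicator_def\<close>)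
  have "expectation (?O k) \<le> expectation (?C k)" for k
  proof -
    have "ennreal (expectation (?O k)) = (\<integral>\<^sup>+\<omega>. ennreal (max 0 (?X (Suc k) \<omega> - h)) * indicator (stays_below ?X h k) \<omega> \<partial>M)"
      by (subst nn_integral_eq_integral[OF intO, symmetric])
         (auto intro!: nn_integral_cong simp: indicator_def)
    also have "\<dots> \<le> (\<integral>\<^sup>+\<omega>. ennreal (s + 1) * indicator {h..} (?X (Suc k) \<omega>) * indicator (stays_below ?X h k) \<omega> \<partial>M)"
      using assms by (intro overshoot) simp
    also have "\<dots> = ennreal (expectation (?C k))"
      by (subst nn_integral_eq_integral[OF intC, symmetric])
         (use assms in \<open>auto intro!: nn_integral_cong simp: indicator_def\<close>)
    finally show ?thesis
      by (subst (asm) ennreal_le_iff) (use assms in \<open>auto intro!: integral_nonneg simp: indicator_def\<close>)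
  qed
  then have "(\<Sum>k<m. expectation (?O k)) \<le> (\<Sum>k<m. expectation (?C k))"
    by (intro sum_mono)
  also have "\<dots> = expectation (\<lambda>\<omega>. \<Sum>k<m. ?C k \<omega>)"
    using intC by (intro Bochner_Integration.integral_sum[symmetric])
  also have "\<dots> \<le> expectation (\<lambda>\<omega>. s + 1)"
  proof (intro integral_mono)
    fix \<omega>
    have "(\<Sum>k<m. indicator {h..} (?X (Suc k) \<omega>) * ?G k \<omega>) \<le> 1"
      using sum_crossings_le_1[of h ?X \<omega> m] by (smt (verit) indicator_pos_le)
    then have "(s + 1) * (\<Sum>k<m. indicator {h..} (?X (Suc k) \<omega>) * ?G k \<omega>) \<le> (s + 1) * 1"
      using assms by (intro mult_left_mono) auto
    then show "(\<Sum>k<m. ?C k \<omega>) \<le> s + 1"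
      unfolding sum_distrib_left[symmetric] by simp
  qed (use intC in auto)
  finally have O: "(\<Sum>k<m. expectation (?O k)) \<le> s + 1"
    by (simp add: prob_space)
  have "s * (\<Sum>k<m. expectation (?G k)) = expectation (\<lambda>\<omega>. \<Sum>k<m. ?G k \<omega> * (V (Suc k) \<omega> + s))"
    by (rule wald_identity(2)[symmetric])
  also have "\<dots> \<le> expectation (\<lambda>\<omega>. h + (\<Sum>k<m. ?O k \<omega>))"
    by (intro integral_mono wald_identity(1) stopped_walk_le(1) assms intO Bochner_Integration.integrable_add
        Bochner_Integration.integrable_sum) simp
  also have "\<dots> = h + (\<Sum>k<m. expectation (?O k))"
    using intO by (subst Bochner_Integration.integral_add)
      (auto intro!: Bochner_Integration.integral_sum Bochner_Integration.integrable_sum simp: prob_space simp del: sum_mult_indicator)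
  finally show ?thesis
    using O by simp
qed

lemma expected_positive_part_walk:
  "expectation (\<lambda>\<omega>. max 0 (drift_walk s V m \<omega> - h)) \<le> max 0 (s * real m - h) + sqrt (real m / (2 * pi))"
\<comment> \<open>The empty sum has variance zero and no density, so \<open>m = 0\<close> is treated
  apart.\<close>
proof (cases "m = 0")
  case False
  let ?Z = "\<lambda>\<omega>. \<Sum>i=1..m. V i \<omega>"
  have Z: "integrable M ?Z" "expectation ?Z = 0" "expectation (\<lambda>\<omega>. \<bar>?Z \<omega>\<bar>) = sqrt (real m) * sqrt (2 / pi)"
    using normal_moments[OF sum_normal[of m]] False by simp_all
  have "expectation (\<lambda>\<omega>. max 0 (drift_walk s V m \<omega> - h)) = expectation (\<lambda>\<omega>. max 0 (s * real m - h + ?Z \<omega>))"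
    by (simp add: drift_walk_def algebra_simps)
  also have "\<dots> \<le> max 0 (s * real m - h) + sqrt (real m) * sqrt (2 / pi) / 2"
    using expectation_positive_part_le[OF Z(1,2)] Z(3) by simp
  also have "sqrt (real m) * sqrt (2 / pi) / 2 = sqrt (real m / (2 * pi))"
    by (rule real_sqrt_unique[symmetric]) (simp_all add: power_divide power_mult_distrib)
  finally show ?thesis .
qed (simp add: drift_walk_0 prob_space)

text \<open>This controls the mean of the positive part of m - T. Subtracting Wald's identity from
  the mean of all \<open>m\<close> increments gives the mean increment after passage, to which
  \<open>early_passage_le\<close> applies pointwise.\<close>

lemma expected_early_passage_le:
  "s * (\<Sum>k<m. 1 - expectation (indicator (stays_below (drift_walk s V) h k)))
    \<le> max 0 (s * real m - h) + sqrt (real m / (2 * pi))"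
proof -
  let ?X = "drift_walk s V"
  let ?G = "\<lambda>k. indicator (stays_below ?X h k) :: 'a \<Rightarrow> real"
  have eq: "(\<lambda>\<omega>. \<Sum>k<m. (1 - ?G k \<omega>) * (V (Suc k) \<omega> + s))
      = (\<lambda>\<omega>. (\<Sum>k<m. V (Suc k) \<omega> + s) - (\<Sum>k<m. ?G k \<omega> * (V (Suc k) \<omega> + s)))"
    by (simp add: algebra_simps sum_subtractf sum.distrib)
  have int: "integrable M (\<lambda>\<omega>. \<Sum>k<m. V (Suc k) \<omega> + s)"
    by (simp add: V_moments)
  have "s * (\<Sum>k<m. 1 - expectation (?G k)) = expectation (\<lambda>\<omega>. \<Sum>k<m. (1 - ?G k \<omega>) * (V (Suc k) \<omega> + s))"
    unfolding eq Bochner_Integration.integral_diff[OF int wald_identity(1)] wald_identity(2)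
    by (simp add: V_moments prob_space sum_subtractf algebra_simps)
  also have "\<dots> \<le> expectation (\<lambda>\<omega>. max 0 (?X m \<omega> - h))"
  proof (rule integral_mono)
    show "integrable M (\<lambda>\<omega>. \<Sum>k<m. (1 - ?G k \<omega>) * (V (Suc k) \<omega> + s))"
      unfolding eq using int by (intro Bochner_Integration.integrable_diff wald_identity)
    show "integrable M (\<lambda>\<omega>. max 0 (?X m \<omega> - h))"
      using integrable_walk by simp
  qed (rule early_passage_le)
  finally show ?thesis
    using expected_positive_part_walk[of s m h] by simp
qed

end

section \<open>Mean deviation of the passage time from h / s\<close>

text \<open>For finite T, the absolute value of c - T plus c equals T plus twice the positive part
  of c - T, and that positive part is at most those of m - T and c - m together. Adding
  \<open>c\<close> on the left avoids subtraction in \<open>ennreal\<close>; for infinite T the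
  right side is infinite.\<close>

lemma passage_time_decomposition:
  fixes X :: "nat \<Rightarrow> 'a \<Rightarrow> real" and c :: real and m :: nat
  assumes "0 \<le> c"
  shows "e2ennreal \<bar>ereal c - first_passage X h \<omega>\<bar> + ennreal c
    \<le> ennreal (2 * (\<Sum>k<m. 1 - indicator (stays_below X h k) \<omega>) + 2 * max 0 (c - real m))
      + (\<Sum>k. indicator (stays_below X h k) \<omega>)"
proof (cases rule: first_passage_cases[of X \<omega> h])
  case 1
  then have "(\<Sum>k. indicator (stays_below X h k) \<omega>) = (\<infinity> :: ennreal)"
    by (simp add: stays_below_def suminf_eq_SUP ennreal_SUP_of_nat_eq_top)
  then show ?thesis
    by simp
next
  case (2 t)
  then have ind: "\<omega> \<in> stays_below X h k \<longleftrightarrow> k < t" for k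
    using 2(1,2) by (auto simp: stays_below_def not_le[symmetric] intro: order.strict_trans1)
  have "(\<Sum>k. indicator (stays_below X h k) \<omega>) = (\<Sum>k<t. indicator (stays_below X h k) \<omega> :: ennreal)"
    by (rule suminf_finite) (auto simp: ind)
  also have "\<dots> = ennreal (real t)"
    by (simp add: ind ennreal_of_nat_eq_real_of_nat)
  finally have 1: "(\<Sum>k. indicator (stays_below X h k) \<omega>) = ennreal (real t)" .
  have "(\<Sum>k<m. 1 - indicator (stays_below X h k) \<omega>) = (\<Sum>k<m. if k < t then 0 else 1 :: real)"
    by (intro sum.cong) (auto simp: ind)
  also have "\<dots> = max 0 (real m - real t)"
    by (induction m) (auto simp: max_def)
  finally have 2: "(\<Sum>k<m. 1 - indicator (stays_below X h k) \<omega>) = max 0 (real m - real t)" .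
  have "\<bar>c - real t\<bar> + c \<le> 2 * max 0 (real m - real t) + 2 * max 0 (c - real m) + real t"
    by (auto simp: max_def abs_if)
  then show ?thesis
    unfolding 1 2 \<open>first_passage X h \<omega> = ereal (real t)\<close> using assms
    by (simp add: e2ennreal_ereal ennreal_plus[symmetric] ennreal_leI del: ennreal_plus)
qed

context gaussian_sequence
begin

text \<open>The decomposition is used with c = h / s. The mean of T is at most (h + s + 1) / s,
  whose leading part cancels against the added c; the early part of T supplies the square
  root.\<close>

lemma passage_time_deviation:
  assumes "0 < s" "0 < h"
  shows "(\<integral>\<^sup>+\<omega>. e2ennreal \<bar>ereal (h / s) - first_passage (drift_walk s V) h \<omega>\<bar> \<partial>M)
    \<le> ennreal (2 + 6 / s + sqrt (2 * h / (pi * s ^ 3)))"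
proof -
  let ?X = "drift_walk s V"
  let ?G = "\<lambda>k. indicator (stays_below ?X h k) :: 'a \<Rightarrow> real"
  \<comment> \<open>Early passage is estimated at integer times only; the nearest integer keeps the
    rounding error at most 1/2.\<close>
  define m where "m = nat (round (h / s))"
  have m: "\<bar>real m - h / s\<bar> \<le> 1 / 2"
    using of_int_round_abs_le[of "h / s"] assms by (simp add: m_def round_def)
  define P where "P = (\<Sum>k<m. 1 - expectation (?G k))"
  define q where "q = max 0 (h / s - real m)"
  have int: "integrable M (?G k)" for k
    by (rule integrable_const_bound[of _ 1]) (auto simp: indicator_def)
  have [measurable]: "(\<lambda>\<omega>. first_passage ?X h \<omega>) \<in> borel_measurable M"
    by (rule borel_measurable_first_passage) auto
  let ?I = "\<integral>\<^sup>+\<omega>. e2ennreal \<bar>ereal (h / s) - first_passage ?X h \<omega>\<bar> \<partial>M"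
  have P: "0 \<le> P"
    unfolding P_def by (intro sum_nonneg) (simp add: prob_le_1)
  have "?I + ennreal (h / s) = (\<integral>\<^sup>+\<omega>. e2ennreal \<bar>ereal (h / s) - first_passage ?X h \<omega>\<bar> + ennreal (h / s) \<partial>M)"
    by (subst nn_integral_add) (simp_all add: emeasure_space_1)
  also have "\<dots> \<le> (\<integral>\<^sup>+\<omega>. ennreal (2 * (\<Sum>k<m. 1 - ?G k \<omega>) + 2 * q) + (\<Sum>k. ennreal (?G k \<omega>)) \<partial>M)"
    using assms passage_time_decomposition[of "h / s" ?X h _ m]
    by (intro nn_integral_mono) (simp add: q_def ennreal_indicator)
  also have "\<dots> = (\<integral>\<^sup>+\<omega>. ennreal (2 * (\<Sum>k<m. 1 - ?G k \<omega>) + 2 * q) \<partial>M) + (\<Sum>k. \<integral>\<^sup>+\<omega>. ennreal (?G k \<omega>) \<partial>M)"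
    by (subst nn_integral_add) (simp_all add: nn_integral_suminf)
  also have "(\<integral>\<^sup>+\<omega>. ennreal (2 * (\<Sum>k<m. 1 - ?G k \<omega>) + 2 * q) \<partial>M) = ennreal (2 * P + 2 * q)"
  proof -
    have "0 \<le> 2 * (\<Sum>k<m. 1 - ?G k \<omega>) + 2 * q" for \<omega>
      by (auto simp: q_def indicator_def intro!: add_nonneg_nonneg sum_nonneg)
    moreover have "integrable M (\<lambda>\<omega>. 2 * (\<Sum>k<m. 1 - ?G k \<omega>) + 2 * q)"
      using int by simp
    ultimately have "(\<integral>\<^sup>+\<omega>. ennreal (2 * (\<Sum>k<m. 1 - ?G k \<omega>) + 2 * q) \<partial>M)
        = ennreal (expectation (\<lambda>\<omega>. 2 * (\<Sum>k<m. 1 - ?G k \<omega>) + 2 * q))"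
      by (intro nn_integral_eq_integral) auto
    also have "expectation (\<lambda>\<omega>. 2 * (\<Sum>k<m. 1 - ?G k \<omega>) + 2 * q) = 2 * P + 2 * q"
      using int unfolding P_def
      by (subst Bochner_Integration.integral_add) (simp_all add: prob_space)
    finally show ?thesis .
  qed
  also have "(\<Sum>k. \<integral>\<^sup>+\<omega>. ennreal (?G k \<omega>) \<partial>M) \<le> ennreal ((h + s + 1) / s)"
  proof -
    have "(\<Sum>k<j. \<integral>\<^sup>+\<omega>. ennreal (?G k \<omega>) \<partial>M) \<le> ennreal ((h + s + 1) / s)" for j
    proof -
      have "(\<Sum>k<j. \<integral>\<^sup>+\<omega>. ennreal (?G k \<omega>) \<partial>M) = (\<Sum>k<j. ennreal (expectation (?G k)))"
        by (intro sum.cong refl nn_integral_eq_integral int) auto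
      also have "\<dots> = ennreal (\<Sum>k<j. expectation (?G k))"
        by (rule sum_ennreal) (auto intro: integral_nonneg)
      also have "\<dots> \<le> ennreal ((h + s + 1) / s)"
        using expected_passage_time_le[OF assms, of j] assms
        by (intro ennreal_leI) (simp add: field_simps)
      finally show ?thesis .
    qed
    then show ?thesis
      unfolding suminf_eq_SUP by (intro SUP_least)
  qed
  finally have "?I + ennreal (h / s) \<le> ennreal (2 * P + 2 * q) + ennreal ((h + s + 1) / s)"
    by simp
  also have "\<dots> \<le> ennreal (2 + 6 / s + sqrt (2 * h / (pi * s ^ 3))) + ennreal (h / s)"
  proof -
    have "s * P \<le> max 0 (s * real m - h) + sqrt (real m / (2 * pi))"
      unfolding P_def by (rule expected_early_passage_le)
    then have "P \<le> (max 0 (s * real m - h) + sqrt (real m / (2 * pi))) / s"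
      using assms by (simp add: field_simps)
    also have "\<dots> = max 0 (real m - h / s) + sqrt (real m / (2 * pi)) / s"
      using assms by (simp add: max_def field_simps)
    finally have P_le: "P \<le> max 0 (real m - h / s) + sqrt (real m / (2 * pi)) / s" .
    \<comment> \<open>The drift excess in the early-passage bound and \<open>q\<close> are the two
      one-sided parts of the same rounding error, so together they cost it only once.\<close>
    have max: "max 0 (real m - h / s) + q = \<bar>real m - h / s\<bar>"
      by (simp add: q_def max_def)
    have double: "2 * x + 2 * y \<le> 2 * z + 2 * b / s" if "x \<le> a + b / s" "a + y = z" for x y z a b
      using that by (simp only: times_divide_eq_right[symmetric])
    have "2 * P + 2 * q \<le> 2 * \<bar>real m - h / s\<bar> + 2 * sqrt (real m / (2 * pi)) / s"
      by (rule double[OF P_le max])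
    also have "\<dots> \<le> 1 + 2 * sqrt (real m / (2 * pi)) / s"
      using m by simp
    also have "2 * sqrt (real m / (2 * pi)) = sqrt (2 * real m / pi)"
      by (rule real_sqrt_unique[symmetric]) (simp_all add: power_mult_distrib)
    \<comment> \<open>Rounding adds at most 1 / pi, hence at most 1, under the root; subadditivity
      of the root then turns this into a summand 1 / s.\<close>
    also have "sqrt (2 * real m / pi) \<le> sqrt (2 * h / (pi * s) + 1)"
    proof (rule real_sqrt_le_mono)
      have "2 * real m \<le> 2 * (h / s) + 1"
        using m by linarith
      then have "2 * real m / pi \<le> (2 * (h / s) + 1) / pi"
        by (rule divide_right_mono) simp
      also have "\<dots> = 2 * h / (pi * s) + 1 / pi"
        by (simp add: add_divide_distrib mult.commute)
      also have "1 / pi \<le> 1"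
        using pi_gt3 by simp
      finally show "2 * real m / pi \<le> 2 * h / (pi * s) + 1"
        by simp
    qed
    also have "\<dots> \<le> sqrt (2 * h / (pi * s)) + sqrt 1"
      using assms by (intro sqrt_add_le_add_sqrt) auto
    finally have "2 * P + 2 * q \<le> 1 + (sqrt (2 * h / (pi * s)) + 1) / s"
      using assms by (simp add: divide_right_mono)
    also have "(sqrt (2 * h / (pi * s)) + 1) / s = sqrt (2 * h / (pi * s ^ 3)) + 1 / s"
    proof -
      have "sqrt (2 * h / (pi * s ^ 3)) = sqrt (2 * h / (pi * s)) / s"
        using assms
        by (intro real_sqrt_unique)
           (simp_all add: power_divide field_simps power2_eq_square power3_eq_cube)
      then show ?thesis
        by (simp add: add_divide_distrib)
    qed
    finally have "2 * P + 2 * q \<le> 1 + (sqrt (2 * h / (pi * s ^ 3)) + 1 / s)" .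
    \<comment> \<open>One summand 1 / s comes from the rounding under the root, the other from the
      mean overshoot. The constant 2 collects twice the rounding error and the drift part of the
      overshoot.\<close>
    moreover have "1 / s + 1 / s \<le> 6 / s" "(h + s + 1) / s = h / s + 1 + 1 / s"
      using assms by (simp_all add: field_simps)
    ultimately have "2 * P + 2 * q + (h + s + 1) / s \<le> 2 + 6 / s + sqrt (2 * h / (pi * s ^ 3)) + h / s"
      by linarith
    then show ?thesis
      using P assms by (simp add: q_def ennreal_plus[symmetric] del: ennreal_plus)
  qed
  finally show ?thesis
    by (simp add: ennreal_add_left_cancel_le add.commute[of _ "ennreal (h / s)"])
qed

end

section \<open>Restarting the walk at time n\<close>

lemma first_passage_shift:
  assumes "\<omega> \<in> stays_below X l n" and shift: "\<And>t. X (n + t) \<omega> = X n \<omega> + X' t \<omega>"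
  shows "first_passage X l \<omega> = ereal (real n) + first_passage X' (l - X n \<omega>) \<omega>"
proof (cases rule: first_passage_cases[of X' \<omega> "l - X n \<omega>"])
  case 1
  have "X t \<omega> < l" for t
  proof (cases "t \<le> n")
    case False
    then show ?thesis
      using shift[of "t - n"] 1(1) by (simp add: algebra_simps)
  qed (use assms(1) in \<open>simp add: stays_below_def\<close>)
  then have "first_passage X l \<omega> = \<infinity>"
    by (cases rule: first_passage_cases[of X \<omega> l]) (use not_less in blast)+
  then show ?thesis
    using 1(2) by simp
next
  case (2 t)
  have before: "X j \<omega> < l" if "j < n + t" for j
  proof (cases "j \<le> n")
    case False
    then show ?thesis
      using shift[of "j - n"] 2(2)[of "j - n"] that by (simp add: algebra_simps)
  qed (use assms(1) in \<open>simp add: stays_below_def\<close>)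
  have at: "l \<le> X (n + t) \<omega>"
    using shift[of t] 2(1) by simp
  show ?thesis
  proof (cases rule: first_passage_cases[of X \<omega> l])
    case 1
    then show ?thesis
      using at by (meson not_le)
  next
    case (2 t')
    then have "t' = n + t"
      using before[of t'] at not_less by (intro antisym leI) blast+
    then show ?thesis
      using 2(3) \<open>first_passage X' (l - X n \<omega>) \<omega> = ereal (real t)\<close> by simp
  qed
qed

lemma (in prob_space) indep_vars_shift:
  assumes "indep_vars (\<lambda>_. N) X {Suc n..}"
  shows "indep_vars (\<lambda>_. N) (\<lambda>i. X (n + i)) {1..}"
  unfolding indep_vars_def2
proof (intro conjI ballI)
  show "random_variable N (X (n + i))" if "i \<in> {1..}" for i
    using assms that by (auto simp: indep_vars_def2)
  have ind: "indep_sets (\<lambda>i. {X i -` A \<inter> space M |A. A \<in> sets N}) {Suc n..}"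
    using assms by (simp add: indep_vars_def2)
  show "indep_sets (\<lambda>i. {X (n + i) -` A \<inter> space M |A. A \<in> sets N}) {1..}"
  proof (rule indep_setsI)
    show "{X (n + i) -` A \<inter> space M |A. A \<in> sets N} \<subseteq> events" if "i \<in> {1..}" for i
      using ind that unfolding indep_sets_def by (auto dest: bspec[of _ _ "n + i"])
    fix A J
    assume J: "J \<noteq> {}" "J \<subseteq> {1..}" "finite J" and A: "\<forall>j\<in>J. A j \<in> {X (n + j) -` A \<inter> space M |A. A \<in> sets N}"
    have "prob (\<Inter>j\<in>(+) n ` J. A (j - n)) = (\<Prod>j\<in>(+) n ` J. prob (A (j - n)))"
      by (rule indep_setsD[OF ind]) (use J A in auto)
    then show "prob (\<Inter>j\<in>J. A j) = (\<Prod>j\<in>J. prob (A j))"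
      by (simp add: prod.reindex inj_on_def)
  qed
qed

context gaussian_sequence
begin

lemma gaussian_sequence_shift: "gaussian_sequence M (\<lambda>i. V (n + i))"
proof
  show "distributed M lborel (V (n + i)) std_normal_density" if "1 \<le> i" for i
    using that by (intro std_normal) simp
  show "indep_vars (\<lambda>_. borel) (\<lambda>i. V (n + i)) {1..}"
    by (intro indep_vars_shift indep_vars_subset[OF indep]) auto
qed

lemma drift_walk_add:
  "drift_walk s V (n + t) \<omega> = drift_walk s V n \<omega> + drift_walk s (\<lambda>i. V (n + i)) t \<omega>"
  by (induction t) (simp_all add: drift_walk_0 drift_walk_Suc)


text \<open>With the first \<open>n\<close> steps frozen, the remaining time is the passage time of
  an independent copy of the walk over the distance \<open>l - X n\<close>, so
  \<open>passage_time_deviation\<close> applies. Averaging the resulting square root uses Jensen's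
  inequality and the mean of the positive part of \<open>l - X n\<close>.\<close>

lemma late_passage_error:
  fixes s l :: real and n :: nat
  defines "X \<equiv> drift_walk s V"
  assumes "0 < s" "1 \<le> n"
  shows "(\<integral>\<^sup>+\<omega>. e2ennreal \<bar>ereal (real n + (l - X n \<omega>) / s) - first_passage X l \<omega>\<bar> * indicator (stays_below X l n) \<omega> \<partial>M)
    \<le> ennreal (2 + 6 / s + sqrt (2 * (max 0 (l - s * real n) + sqrt (real n / (2 * pi))) / (pi * s ^ 3)))"
proof -
  interpret V': gaussian_sequence M "\<lambda>i. V (n + i)"
    by (rule gaussian_sequence_shift)
  let ?S = "PiM {1..n} (\<lambda>_. borel) :: (nat \<Rightarrow> real) measure"
  let ?T = "PiM {Suc n..} (\<lambda>_. borel) :: (nat \<Rightarrow> real) measure"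
  let ?A = "\<lambda>\<omega>. \<lambda>i\<in>{1..n}. V i \<omega>" and ?B = "\<lambda>\<omega>. \<lambda>i\<in>{Suc n..}. V i \<omega>"
  let ?X = "drift_walk s (\<lambda>i v. v i)" and ?X' = "drift_walk s (\<lambda>i v. v (n + i))"
  let ?f = "\<lambda>(a, b). e2ennreal \<bar>ereal ((l - ?X n a) / s) - first_passage ?X' (l - ?X n a) b\<bar>
    * ennreal (indicator (stays_below ?X l n) a)"
  \<comment> \<open>On the event in question \<open>W\<close> is the remaining distance; as a
    positive part it is nonnegative everywhere, so the square root can be averaged over the whole
    space.\<close>
  define W where "W \<omega> = max 0 (l - X n \<omega>)" for \<omega>
  have Z: "integrable M (\<lambda>\<omega>. \<Sum>i=1..n. V i \<omega>)" "expectation (\<lambda>\<omega>. \<Sum>i=1..n. V i \<omega>) = 0"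
      "expectation (\<lambda>\<omega>. \<bar>\<Sum>i=1..n. V i \<omega>\<bar>) = sqrt (real n) * sqrt (2 / pi)"
    using normal_moments[OF sum_normal[of n]] assms by simp_all
  have W: "integrable M W" "0 \<le> W \<omega>" for \<omega>
    using integrable_walk unfolding W_def X_def by auto
  have EW: "expectation W \<le> max 0 (l - s * real n) + sqrt (real n / (2 * pi))"
  proof -
    have "expectation W = expectation (\<lambda>\<omega>. max 0 (l - s * real n + - (\<Sum>i=1..n. V i \<omega>)))"
      by (intro Bochner_Integration.integral_cong) (simp_all add: W_def X_def drift_walk_def algebra_simps)
    also have "\<dots> \<le> max 0 (l - s * real n) + expectation (\<lambda>\<omega>. \<bar>- (\<Sum>i=1..n. V i \<omega>)\<bar>) / 2"
      using Z by (intro expectation_positive_part_le) auto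
    also have "expectation (\<lambda>\<omega>. \<bar>- (\<Sum>i=1..n. V i \<omega>)\<bar>) / 2 = sqrt (real n) * sqrt (2 / pi) / 2"
      using Z by simp
    also have "\<dots> = sqrt (real n / (2 * pi))"
      by (rule real_sqrt_unique[symmetric]) (simp_all add: power_divide power_mult_distrib)
    finally show ?thesis .
  qed
  have walk_past: "?X n (?A \<omega>) = X n \<omega>" for \<omega>
    unfolding X_def by (rule drift_walk_restrict) simp
  have stays_past: "(indicator (stays_below ?X l n) (?A \<omega>) :: real) = indicator (stays_below X l n) \<omega>" for \<omega>
    unfolding X_def indicator_def by (subst stays_below_restrict) auto
  have walk': "?X' t (?B \<omega>) = drift_walk s (\<lambda>i. V (n + i)) t \<omega>" for t \<omega>
    unfolding drift_walk_def by (auto intro!: sum.cong)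
  have fp': "first_passage ?X' h (?B \<omega>) = first_passage (drift_walk s (\<lambda>i. V (n + i))) h \<omega>" for h \<omega>
    unfolding first_passage_def walk' ..
  have [measurable]: "?X n \<in> borel_measurable ?S" "(indicator (stays_below ?X l n) :: _ \<Rightarrow> real) \<in> borel_measurable ?S"
    by (auto intro: measurable_coordinate_walk indicator_coordinate_stays_below)
  have [measurable]: "?X' t \<in> borel_measurable ?T" for t
    by (rule drift_walk_measurable) auto
  \<comment> \<open>Joint measurability in past and future: the level depends on the first
    component, the walk on the second.\<close>
  have [measurable]: "(\<lambda>z. first_passage ?X' (l - ?X n (fst z)) (snd z)) \<in> borel_measurable (?S \<Otimes>\<^sub>M ?T)"
  proof -
    have "(\<lambda>z. first_passage (\<lambda>t z. ?X' t (snd z)) (l - ?X n (fst z)) z) \<in> borel_measurable (?S \<Otimes>\<^sub>M ?T)"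
      by (rule borel_measurable_first_passage) measurable
    then show ?thesis
      unfolding first_passage_def .
  qed
  have "(\<integral>\<^sup>+\<omega>. e2ennreal \<bar>ereal (real n + (l - X n \<omega>) / s) - first_passage X l \<omega>\<bar> * indicator (stays_below X l n) \<omega> \<partial>M)
      = (\<integral>\<^sup>+\<omega>. ?f (?A \<omega>, ?B \<omega>) \<partial>M)"
  proof (rule nn_integral_cong)
    fix \<omega>
    show "e2ennreal \<bar>ereal (real n + (l - X n \<omega>) / s) - first_passage X l \<omega>\<bar> * indicator (stays_below X l n) \<omega>
        = ?f (?A \<omega>, ?B \<omega>)"
    proof (cases "\<omega> \<in> stays_below X l n")
      case True
      \<comment> \<open>The finite shift cancels even when the remaining passage time is
        infinite.\<close>
      have eq: "\<bar>ereal (a + x) - (ereal a + y)\<bar> = \<bar>ereal x - y\<bar>" for a x y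
        by (cases y) simp_all
      have "first_passage X l \<omega>
          = ereal (real n) + first_passage (drift_walk s (\<lambda>i. V (n + i))) (l - X n \<omega>) \<omega>"
        by (rule first_passage_shift[where X = X and X' = "drift_walk s (\<lambda>i. V (n + i))", OF True])
           (simp add: X_def drift_walk_add)
      then show ?thesis
        using True unfolding prod.case fp' walk_past stays_past by (simp add: eq)
    next
      case False
      then show ?thesis
        unfolding prod.case stays_past by simp
    qed
  qed
  also have "\<dots> = (\<integral>\<^sup>+\<omega>. (\<integral>\<^sup>+\<omega>'. ?f (?A \<omega>, ?B \<omega>') \<partial>M) \<partial>M)"
    by (rule indep_var_nn_integral_pair[OF indep_past_future]) (unfold case_prod_beta, measurable)
  also have "\<dots> \<le> (\<integral>\<^sup>+\<omega>. ennreal (2 + 6 / s + sqrt (2 * W \<omega> / (pi * s ^ 3))) \<partial>M)"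
  proof (rule nn_integral_mono)
    fix \<omega>
    show "(\<integral>\<^sup>+\<omega>'. ?f (?A \<omega>, ?B \<omega>') \<partial>M) \<le> ennreal (2 + 6 / s + sqrt (2 * W \<omega> / (pi * s ^ 3)))"
    proof (cases "\<omega> \<in> stays_below X l n")
      case True
      then have h: "0 < l - X n \<omega>"
        by (auto simp: stays_below_def)
      then have "W \<omega> = l - X n \<omega>"
        by (simp add: W_def)
      moreover have "(\<integral>\<^sup>+\<omega>'. ?f (?A \<omega>, ?B \<omega>') \<partial>M)
          = (\<integral>\<^sup>+\<omega>'. e2ennreal \<bar>ereal ((l - X n \<omega>) / s) - first_passage (drift_walk s (\<lambda>i. V (n + i))) (l - X n \<omega>) \<omega>'\<bar> \<partial>M)"
        using True unfolding prod.case fp' walk_past stays_past by simp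
      ultimately show ?thesis
        using V'.passage_time_deviation[OF assms(2) h] by simp
    next
      case False
      then show ?thesis
        unfolding prod.case stays_past by simp
    qed
  qed
  also have "\<dots> \<le> ennreal (2 + 6 / s + sqrt (2 * (max 0 (l - s * real n) + sqrt (real n / (2 * pi))) / (pi * s ^ 3)))"
  proof -
    let ?U = "\<lambda>\<omega>. 2 * W \<omega> / (pi * s ^ 3)"
    have U: "integrable M ?U" "0 \<le> ?U \<omega>" for \<omega>
      using W assms by auto
    note sqrt = expectation_sqrt_le[OF U]
    have "(\<integral>\<^sup>+\<omega>. ennreal (2 + 6 / s + sqrt (?U \<omega>)) \<partial>M) = ennreal (expectation (\<lambda>\<omega>. 2 + 6 / s + sqrt (?U \<omega>)))"
      by (rule nn_integral_eq_integral) (use sqrt(1) U(2) assms in \<open>auto intro!: AE_I2 add_nonneg_nonneg simp del: divide_nonneg_pos\<close>)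
    also have "expectation (\<lambda>\<omega>. 2 + 6 / s + sqrt (?U \<omega>)) = 2 + 6 / s + expectation (\<lambda>\<omega>. sqrt (?U \<omega>))"
      using sqrt(1) by (subst Bochner_Integration.integral_add) (simp_all add: prob_space)
    also have "\<dots> \<le> 2 + 6 / s + sqrt (expectation ?U)"
      using sqrt(2) by simp
    also have "expectation ?U = 2 * expectation W / (pi * s ^ 3)"
      by simp
    also have "\<dots> \<le> 2 * (max 0 (l - s * real n) + sqrt (real n / (2 * pi))) / (pi * s ^ 3)"
      using EW assms by (intro divide_right_mono mult_left_mono) auto
    finally show ?thesis
      by (simp add: ennreal_leI)
  qed
  finally show ?thesis .
qed


section \<open>Passage by time n\<close>

lemma prob_walk_ge:
  assumes "1 \<le> t"
  shows "prob {\<omega> \<in> space M. l \<le> drift_walk s V t \<omega>} = gaussian_Q ((l - s * real t) / sqrt (real t))"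
proof -
  have "distributed M lborel (\<lambda>\<omega>. (\<Sum>i=1..t. V i \<omega>) / sqrt (real t)) std_normal_density"
    using sum_normal[OF assms] normal_standard_normal_convert[of "sqrt (real t)" _ 0] assms by simp
  from prob_ge_std_normal[OF this, of "(l - s * real t) / sqrt (real t)"] show ?thesis
    using assms by (simp add: drift_walk_def divide_le_cancel diff_le_eq)
qed

text \<open>A union bound over the times 1 to \<open>n\<close>. The normalized gap (l - s t) / sqrt
  t decreases in t, since its numerator is positive and decreasing; the tail at time
  \<open>n\<close> therefore dominates all the others.\<close>

lemma prob_early_passage_le:
  fixes s l :: real and n :: nat
  assumes "0 < s" "0 < l" "s * real n < l"
  shows "prob (space M - stays_below (drift_walk s V) l n) \<le> real n * gaussian_Q ((l - s * real n) / sqrt (real n))"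
proof -
  let ?X = "drift_walk s V"
  have "space M - stays_below ?X l n \<subseteq> (\<Union>t\<in>{1..n}. {\<omega> \<in> space M. l \<le> ?X t \<omega>})"
  proof
    fix \<omega> assume "\<omega> \<in> space M - stays_below ?X l n"
    then obtain t where t: "t \<le> n" "l \<le> ?X t \<omega>" "\<omega> \<in> space M"
      by (auto simp: stays_below_def not_less)
    then have "t \<noteq> 0"
      using assms by (cases "t = 0") (auto simp: drift_walk_0)
    with t show "\<omega> \<in> (\<Union>t\<in>{1..n}. {\<omega> \<in> space M. l \<le> ?X t \<omega>})"
      by (auto intro!: bexI[of _ t])
  qed
  then have "prob (space M - stays_below ?X l n) \<le> prob (\<Union>t\<in>{1..n}. {\<omega> \<in> space M. l \<le> ?X t \<omega>})"
    by (intro finite_measure_mono) auto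
  also have "\<dots> \<le> (\<Sum>t=1..n. prob {\<omega> \<in> space M. l \<le> ?X t \<omega>})"
    by (intro finite_measure_subadditive_finite) auto
  also have "\<dots> \<le> (\<Sum>t=1..n. gaussian_Q ((l - s * real n) / sqrt (real n)))"
  proof (rule sum_mono)
    fix t assume t: "t \<in> {1..n}"
    then have "s * real t \<le> s * real n"
      using assms by simp
    have "(l - s * real n) / sqrt (real n) \<le> (l - s * real t) / sqrt (real t)"
    proof (rule frac_le)
      show "0 \<le> l - s * real t" "l - s * real n \<le> l - s * real t"
        using \<open>s * real t \<le> s * real n\<close> assms(3) by linarith+
    qed (use t in auto)
    then show "prob {\<omega> \<in> space M. l \<le> ?X t \<omega>} \<le> gaussian_Q ((l - s * real n) / sqrt (real n))"
      using t by (simp add: prob_walk_ge gaussian_Q_antimono)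
  qed
  finally show ?thesis
    by simp
qed


text \<open>With Z the centred walk at time \<open>n\<close> and passage at t <= n, the error is ((l
  - s t) - Z) / s, and \<open>\<bar>l - s * t\<bar> \<le> l\<close>. Cauchy--Schwarz handles Z,
  whose second moment is \<open>n\<close>, and the union bound replaces the probability of early
  passage by n Q.\<close>

lemma early_passage_error:
  fixes s l :: real and n :: nat
  defines "X \<equiv> drift_walk s V"
  assumes "0 < s" "0 < l" "1 \<le> n" "s * real n < l"
  shows "(\<integral>\<^sup>+\<omega>. e2ennreal \<bar>ereal (real n + (l - X n \<omega>) / s) - first_passage X l \<omega>\<bar> * indicator (- stays_below X l n) \<omega> \<partial>M)
    \<le> ennreal ((sqrt (real n) * l + real n) / s * sqrt (gaussian_Q ((l - s * real n) / sqrt (real n))))"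
proof -
  define Z where "Z \<omega> = (\<Sum>i=1..n. V i \<omega>)" for \<omega>
  let ?A = "space M - stays_below X l n"
  define Q where "Q = gaussian_Q ((l - s * real n) / sqrt (real n))"
  have [measurable]: "Z \<in> borel_measurable M"
    unfolding Z_def using measurable_V by (intro borel_measurable_sum) auto
  have [measurable]: "?A \<in> events"
  proof -
    have "{\<omega> \<in> space M. \<omega> \<notin> stays_below X l n} \<in> events"
      unfolding X_def by measurable
    then show ?thesis
      by (simp add: set_diff_eq)
  qed
  have moment: "integrable M (\<lambda>\<omega>. (Z \<omega>)\<^sup>2)" "expectation (\<lambda>\<omega>. (Z \<omega>)\<^sup>2) = real n"
    using normal_moments[OF sum_normal[of n]] assms by (simp_all add: Z_def)
  have p: "prob ?A \<le> real n * Q"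
    unfolding X_def Q_def using assms by (intro prob_early_passage_le)
  have Q: "0 \<le> Q"
    by (simp add: Q_def gaussian_Q_nonneg)
  have "(\<integral>\<^sup>+\<omega>. e2ennreal \<bar>ereal (real n + (l - X n \<omega>) / s) - first_passage X l \<omega>\<bar> * indicator (- stays_below X l n) \<omega> \<partial>M)
      \<le> (\<integral>\<^sup>+\<omega>. ennreal (1 / s) * (ennreal l * indicator ?A \<omega> + ennreal \<bar>Z \<omega>\<bar> * indicator ?A \<omega>) \<partial>M)"
  proof (rule nn_integral_mono)
    fix \<omega> assume \<omega>: "\<omega> \<in> space M"
    show "e2ennreal \<bar>ereal (real n + (l - X n \<omega>) / s) - first_passage X l \<omega>\<bar> * indicator (- stays_below X l n) \<omega>
        \<le> ennreal (1 / s) * (ennreal l * indicator ?A \<omega> + ennreal \<bar>Z \<omega>\<bar> * indicator ?A \<omega>)"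
    proof (cases "\<omega> \<in> stays_below X l n")
      case False
      then obtain j where j: "j \<le> n" "l \<le> X j \<omega>"
        by (auto simp: stays_below_def not_less)
      obtain t where t: "t \<le> n" "first_passage X l \<omega> = ereal (real t)"
      proof (cases rule: first_passage_cases[of X \<omega> l])
        case 1
        then show ?thesis
          using j by (meson not_le)
      next
        case (2 t)
        then show ?thesis
          using that[of t] j by (meson not_le le_trans)
      qed
      have "0 \<le> s * real t" "s * real t \<le> s * real n"
        using t assms by auto
      then have "\<bar>l - s * real t\<bar> \<le> l"
        using assms by linarith
      moreover have "real n + (l - X n \<omega>) / s - real t = 1 / s * ((l - s * real t) - Z \<omega>)"
        using assms by (simp add: X_def Z_def drift_walk_def field_simps)
      ultimately have "\<bar>real n + (l - X n \<omega>) / s - real t\<bar> \<le> 1 / s * (l + \<bar>Z \<omega>\<bar>)"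
        using assms by (simp only: abs_mult) (intro mult_mono, auto)
      then show ?thesis
        using False \<omega> t assms(2,3)
        by (simp add: e2ennreal_ereal ennreal_mult[symmetric] ennreal_plus[symmetric] ennreal_leI del: ennreal_plus)
    qed simp
  qed
  also have "\<dots> = ennreal (1 / s) * (ennreal l * ennreal (prob ?A) + (\<integral>\<^sup>+\<omega>. ennreal \<bar>Z \<omega>\<bar> * indicator ?A \<omega> \<partial>M))"
    by (subst nn_integral_cmult, measurable, subst nn_integral_add)
       (simp_all add: nn_integral_cmult emeasure_eq_measure)
  also have "\<dots> \<le> ennreal (1 / s) * (ennreal l * ennreal (sqrt (prob ?A)) + ennreal (sqrt (real n * prob ?A)))"
  proof (intro mult_left_mono add_mono)
    \<comment> \<open>Weakening the probability to its square root lets the constant part of the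
      error share the factor \<open>sqrt Q\<close> with the Cauchy--Schwarz part.\<close>
    have "prob ?A \<le> sqrt (prob ?A)"
      by (intro real_le_rsqrt) (simp add: power2_eq_square mult_left_le)
    then show "ennreal (prob ?A) \<le> ennreal (sqrt (prob ?A))"
      by (rule ennreal_leI)
    show "(\<integral>\<^sup>+\<omega>. ennreal \<bar>Z \<omega>\<bar> * indicator ?A \<omega> \<partial>M) \<le> ennreal (sqrt (real n * prob ?A))"
      using expectation_abs_indicator_le[OF _ moment(1), of ?A] moment(2) by simp
  qed auto
  also have "\<dots> = ennreal (1 / s * (l * sqrt (prob ?A) + sqrt (real n * prob ?A)))"
  proof -
    have "ennreal (1 / s) * (ennreal l * ennreal a + ennreal b) = ennreal (1 / s * (l * a + b))"
      if "0 \<le> a" "0 \<le> b" for a b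
      using assms(2,3) that by (simp add: ennreal_mult[symmetric] ennreal_plus[symmetric] del: ennreal_plus)
    then show ?thesis
      by simp
  qed
  also have "\<dots> \<le> ennreal ((sqrt (real n) * l + real n) / s * sqrt Q)"
  proof (rule ennreal_leI)
    have "1 / s * (l * sqrt (prob ?A) + sqrt (real n * prob ?A)) \<le> 1 / s * (l * sqrt (real n * Q) + sqrt (real n * (real n * Q)))"
      using p assms by (intro mult_left_mono add_mono real_sqrt_le_mono) auto
    also have "\<dots> = (sqrt (real n) * l + real n) / s * sqrt Q"
      using assms(4) by (simp add: real_sqrt_mult algebra_simps add_divide_distrib)
    finally show "1 / s * (l * sqrt (prob ?A) + sqrt (real n * prob ?A)) \<le> (sqrt (real n) * l + real n) / s * sqrt Q" .
  qed
  finally show ?thesis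
    unfolding Q_def .
qed

end

section \<open>Reflection of the noise\<close>

abbreviation std_gaussian_measure :: "real measure" where
  "std_gaussian_measure \<equiv> density lborel std_normal_density"

lemma nn_integral_std_gaussian_pair:
  assumes [measurable]: "f \<in> borel_measurable (borel \<Otimes>\<^sub>M borel)"
  shows "(\<integral>\<^sup>+z. f z \<partial>(std_gaussian_measure \<Otimes>\<^sub>M std_gaussian_measure))
    = (\<integral>\<^sup>+x. \<integral>\<^sup>+y. ennreal (std_normal_density x * std_normal_density y) * f (x, y) \<partial>lborel \<partial>lborel)"
proof -
  interpret N: prob_space std_gaussian_measure
    by (rule prob_space_normal_density) simp
  have "(\<integral>\<^sup>+z. f z \<partial>(std_gaussian_measure \<Otimes>\<^sub>M std_gaussian_measure))
      = (\<integral>\<^sup>+x. \<integral>\<^sup>+y. f (x, y) \<partial>std_gaussian_measure \<partial>std_gaussian_measure)"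
    by (rule N.nn_integral_fst[symmetric]) simp
  also have "\<dots> = (\<integral>\<^sup>+x. ennreal (std_normal_density x) * (\<integral>\<^sup>+y. ennreal (std_normal_density y) * f (x, y) \<partial>lborel) \<partial>lborel)"
    by (simp add: nn_integral_density)
  also have "\<dots> = (\<integral>\<^sup>+x. \<integral>\<^sup>+y. ennreal (std_normal_density x * std_normal_density y) * f (x, y) \<partial>lborel \<partial>lborel)"
    by (intro nn_integral_cong) (simp add: nn_integral_cmult[symmetric] ennreal_mult mult.assoc)
  finally show ?thesis .
qed

text \<open>Two one-dimensional affine substitutions separated by an exchange of the integrals. Each
  produces the factor \<open>\<bar>d\<bar>\<close>, on opposite sides, and it cancels because
  \<open>d\<close> is nonzero.\<close>

lemma nn_integral_lborel_reflection:
  fixes F :: "real \<times> real \<Rightarrow> ennreal"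
  assumes [measurable]: "F \<in> borel_measurable (borel \<Otimes>\<^sub>M borel)"
    and "c\<^sup>2 + d\<^sup>2 = 1" "d \<noteq> 0"
  shows "(\<integral>\<^sup>+x. \<integral>\<^sup>+y. F (c * x + d * y, d * x - c * y) \<partial>lborel \<partial>lborel)
    = (\<integral>\<^sup>+x. \<integral>\<^sup>+y. F (x, y) \<partial>lborel \<partial>lborel)" (is "?L = ?R")
proof -
  have "ennreal \<bar>d\<bar> * ?L = (\<integral>\<^sup>+x. ennreal \<bar>d\<bar> * (\<integral>\<^sup>+y. F (c * x + d * y, d * x - c * y) \<partial>lborel) \<partial>lborel)"
    by (simp add: nn_integral_cmult)
  also have "\<dots> = (\<integral>\<^sup>+x. \<integral>\<^sup>+u. F (u, (x - c * u) / d) \<partial>lborel \<partial>lborel)"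
  proof (rule nn_integral_cong)
    fix x
    \<comment> \<open>With the new first coordinate u = c x + d y, the second one becomes (x - c u)
      / d; this is where c and d being the coordinates of a unit vector enters.\<close>
    have "(x - c * (c * x + d * y)) / d = d * x - c * y" for y
    proof -
      have "x - c * (c * x + d * y) = x * (c\<^sup>2 + d\<^sup>2) - c * (c * x + d * y)"
        using assms by simp
      also have "\<dots> = d * (d * x - c * y)"
        by (simp add: algebra_simps power2_eq_square)
      finally show ?thesis
        using assms by simp
    qed
    then show "ennreal \<bar>d\<bar> * (\<integral>\<^sup>+y. F (c * x + d * y, d * x - c * y) \<partial>lborel)
        = (\<integral>\<^sup>+u. F (u, (x - c * u) / d) \<partial>lborel)"
      using assms by (subst nn_integral_real_affine[of _ d "c * x"]) simp_all
  qed
  also have "\<dots> = (\<integral>\<^sup>+u. \<integral>\<^sup>+x. F (u, (x - c * u) / d) \<partial>lborel \<partial>lborel)"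
    by (rule lborel_pair.Fubini') simp
  also have "\<dots> = (\<integral>\<^sup>+u. ennreal \<bar>d\<bar> * (\<integral>\<^sup>+v. F (u, v) \<partial>lborel) \<partial>lborel)"
  proof (rule nn_integral_cong)
    fix u
    show "(\<integral>\<^sup>+x. F (u, (x - c * u) / d) \<partial>lborel) = ennreal \<bar>d\<bar> * (\<integral>\<^sup>+v. F (u, v) \<partial>lborel)"
      using assms(3) by (subst nn_integral_real_affine[of _ d "c * u"]) simp_all
  qed
  also have "\<dots> = ennreal \<bar>d\<bar> * ?R"
    by (simp add: nn_integral_cmult)
  finally show ?thesis
    using assms(3) by (simp add: ennreal_mult_cancel_left)
qed

text \<open>Subtracting twice the orthogonal projection onto the direction (\<epsilon>, -1) gives
  the reflection of the plane in the line through the origin and (1, \<epsilon>).\<close>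

definition reflect :: "real \<Rightarrow> real \<times> real \<Rightarrow> real \<times> real" where
  "reflect \<epsilon> = (\<lambda>(v, w). let k = 2 * (\<epsilon> * v - w) / (1 + \<epsilon>\<^sup>2) in (v - \<epsilon> * k, w + k))"

lemma measurable_reflect[measurable]: "reflect \<epsilon> \<in> borel \<Otimes>\<^sub>M borel \<rightarrow>\<^sub>M borel \<Otimes>\<^sub>M borel"
  unfolding reflect_def Let_def by measurable

lemma reflect_observation: "fst (reflect \<epsilon> p) + \<epsilon> * snd (reflect \<epsilon> p) = fst p + \<epsilon> * snd p"
  by (simp add: reflect_def case_prod_beta Let_def algebra_simps)

lemma fst_reflect: "fst (reflect \<epsilon> p) = fst p - 2 * \<epsilon> / (1 + \<epsilon>\<^sup>2) * (\<epsilon> * fst p - snd p)"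
  by (simp add: reflect_def case_prod_beta Let_def)

text \<open>The reflection is an orthogonal map: it preserves Lebesgue measure, and it preserves the
  product density, which depends only on the squared norm.\<close>

lemma distr_std_gaussian_pair_reflect:
  assumes "\<epsilon> \<noteq> 0"
  shows "distr (std_gaussian_measure \<Otimes>\<^sub>M std_gaussian_measure) (borel \<Otimes>\<^sub>M borel) (reflect \<epsilon>)
    = std_gaussian_measure \<Otimes>\<^sub>M std_gaussian_measure"
proof (rule measure_eqI)
  let ?N = "std_gaussian_measure \<Otimes>\<^sub>M std_gaussian_measure" and ?\<phi> = std_normal_density
  \<comment> \<open>If \<epsilon> is the tangent of an angle, \<open>c\<close> and \<open>d\<close>
    are the cosine and sine of twice that angle, the entries of the reflection matrix.\<close>
  define c where "c = (1 - \<epsilon>\<^sup>2) / (1 + \<epsilon>\<^sup>2)"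
  define d where "d = 2 * \<epsilon> / (1 + \<epsilon>\<^sup>2)"
  have pos: "0 < 1 + \<epsilon>\<^sup>2"
    by (simp add: add_pos_nonneg)
  have "(1 - \<epsilon>\<^sup>2)\<^sup>2 + (2 * \<epsilon>)\<^sup>2 = (1 + \<epsilon>\<^sup>2)\<^sup>2"
    by (simp add: power2_eq_square algebra_simps)
  then have cd: "c\<^sup>2 + d\<^sup>2 = 1" "d \<noteq> 0"
    using pos assms by (auto simp: c_def d_def power_divide simp flip: add_divide_distrib)
  have refl: "reflect \<epsilon> (x, y) = (c * x + d * y, d * x - c * y)" for x y
  proof -
    have c: "1 - \<epsilon> * d = c" "2 / (1 + \<epsilon>\<^sup>2) = 1 + c"
      using pos by (auto simp: c_def d_def field_simps power2_eq_square)
    have d: "\<epsilon> * (1 + c) = d"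
      unfolding c(2)[symmetric] by (simp add: d_def)
    have k: "2 * (\<epsilon> * x - y) / (1 + \<epsilon>\<^sup>2) = d * x - (1 + c) * y"
      unfolding c(2)[symmetric] by (simp add: d_def diff_divide_distrib algebra_simps)
    have "x - \<epsilon> * (d * x - (1 + c) * y) = (1 - \<epsilon> * d) * x + (\<epsilon> * (1 + c)) * y"
      by (simp add: algebra_simps)
    then show ?thesis
      unfolding reflect_def prod.case Let_def k c d by (simp add: algebra_simps)
  qed
  have dens: "?\<phi> x * ?\<phi> y = ?\<phi> (c * x + d * y) * ?\<phi> (d * x - c * y)" for x y
  proof -
    have "(c * x + d * y)\<^sup>2 + (d * x - c * y)\<^sup>2 = (c\<^sup>2 + d\<^sup>2) * (x\<^sup>2 + y\<^sup>2)"
      by (simp add: power2_eq_square algebra_simps)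
    then have "- x\<^sup>2 / 2 + - y\<^sup>2 / 2 = - (c * x + d * y)\<^sup>2 / 2 + - (d * x - c * y)\<^sup>2 / 2"
      unfolding cd by (simp add: field_simps)
    then show ?thesis
      unfolding std_normal_density_def by (simp flip: exp_add)
  qed
  show "sets (distr ?N (borel \<Otimes>\<^sub>M borel) (reflect \<epsilon>)) = sets ?N"
    by (simp cong: sets_pair_measure_cong)
  fix A assume "A \<in> sets (distr ?N (borel \<Otimes>\<^sub>M borel) (reflect \<epsilon>))"
  then have A[measurable]: "A \<in> sets (borel \<Otimes>\<^sub>M borel)"
    by simp
  have [simp]: "A \<in> sets ?N"
    using A by (simp cong: sets_pair_measure_cong)
  have [measurable]: "reflect \<epsilon> \<in> ?N \<rightarrow>\<^sub>M borel \<Otimes>\<^sub>M borel"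
    using measurable_reflect by (simp cong: measurable_cong_sets sets_pair_measure_cong)
  have "emeasure (distr ?N (borel \<Otimes>\<^sub>M borel) (reflect \<epsilon>)) A
      = (\<integral>\<^sup>+z. indicator A z \<partial>distr ?N (borel \<Otimes>\<^sub>M borel) (reflect \<epsilon>))"
    by simp
  also have "\<dots> = (\<integral>\<^sup>+z. indicator A (reflect \<epsilon> z) \<partial>?N)"
    by (subst nn_integral_distr) auto
  also have "\<dots> = (\<integral>\<^sup>+x. \<integral>\<^sup>+y. ennreal (?\<phi> x * ?\<phi> y) * indicator A (reflect \<epsilon> (x, y)) \<partial>lborel \<partial>lborel)"
    by (rule nn_integral_std_gaussian_pair) measurable
  also have "\<dots> = (\<integral>\<^sup>+x. \<integral>\<^sup>+y. (\<lambda>z. ennreal (?\<phi> (fst z) * ?\<phi> (snd z)) * indicator A z) (c * x + d * y, d * x - c * y) \<partial>lborel \<partial>lborel)"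
    by (simp only: dens[symmetric] refl fst_conv snd_conv)
  also have "\<dots> = (\<integral>\<^sup>+x. \<integral>\<^sup>+y. ennreal (?\<phi> x * ?\<phi> y) * indicator A (x, y) \<partial>lborel \<partial>lborel)"
    by (subst nn_integral_lborel_reflection[OF _ cd]) auto
  also have "\<dots> = (\<integral>\<^sup>+z. indicator A z \<partial>?N)"
    by (rule nn_integral_std_gaussian_pair[symmetric]) measurable
  finally show "emeasure (distr ?N (borel \<Otimes>\<^sub>M borel) (reflect \<epsilon>)) A = emeasure ?N A"
    by simp
qed

section \<open>Independence of the pairs of steps\<close>

text \<open>On preimages of rectangles the probability factors first between the two sequences and
  then over the indices. These preimages are closed under intersection, so independence passes to
  the sigma-algebras they generate, for which the pairs are measurable.\<close>

lemma (in prob_space) indep_vars_Pair: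
  assumes V: "indep_vars (\<lambda>_. N) V I" and W: "indep_vars (\<lambda>_. N) W I"
    and VW: "indep_var (PiM I (\<lambda>_. N)) (\<lambda>\<omega>. \<lambda>i\<in>I. V i \<omega>) (PiM I (\<lambda>_. N)) (\<lambda>\<omega>. \<lambda>i\<in>I. W i \<omega>)"
  shows "indep_vars (\<lambda>_. N \<Otimes>\<^sub>M N) (\<lambda>i \<omega>. (V i \<omega>, W i \<omega>)) I"
proof -
  have rv: "random_variable N (V i)" "random_variable N (W i)" if "i \<in> I" for i
    using V W that by (auto simp: indep_vars_def2)
  define E where "E i = {V i -` A \<inter> W i -` B \<inter> space M | A B. A \<in> sets N \<and> B \<in> sets N}" for i
  have factor: "prob (\<Inter>j\<in>J. V j -` A j \<inter> W j -` B j \<inter> space M)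
      = (\<Prod>j\<in>J. prob (V j -` A j \<inter> space M)) * (\<Prod>j\<in>J. prob (W j -` B j \<inter> space M))"
    if J: "J \<noteq> {}" "J \<subseteq> I" "finite J" and AB: "\<And>j. j \<in> J \<Longrightarrow> A j \<in> sets N" "\<And>j. j \<in> J \<Longrightarrow> B j \<in> sets N" for J A B
  proof -
    have cyl: "{v \<in> space (PiM I (\<lambda>_. N)). \<forall>j\<in>J. v j \<in> C j} \<in> sets (PiM I (\<lambda>_. N))"
      if "\<And>j. j \<in> J \<Longrightarrow> C j \<in> sets N" for C
    proof (rule sets.sets_Collect_finite_All')
      fix j assume j: "j \<in> J"
      then have "(\<lambda>v. v j) -` C j \<inter> space (PiM I (\<lambda>_. N)) \<in> sets (PiM I (\<lambda>_. N))"
        using J that by (intro measurable_sets[OF measurable_component_singleton]) auto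
      then show "{v \<in> space (PiM I (\<lambda>_. N)). v j \<in> C j} \<in> sets (PiM I (\<lambda>_. N))"
        by (simp add: vimage_def Int_def conj_commute)
    qed (use J in auto)
    have pre: "(\<lambda>\<omega>. \<lambda>i\<in>I. U i \<omega>) -` {v \<in> space (PiM I (\<lambda>_. N)). \<forall>j\<in>J. v j \<in> C j} \<inter> space M
        = (\<Inter>j\<in>J. U j -` C j \<inter> space M)"
      if "\<forall>i\<in>I. random_variable N (U i)" for U :: "_ \<Rightarrow> 'a \<Rightarrow> 'c" and C
      using J measurable_space[OF bspec[OF that]] by (auto simp: space_PiM PiE_def Pi_def subset_eq)
    have rvs: "\<forall>i\<in>I. random_variable N (V i)" "\<forall>i\<in>I. random_variable N (W i)"
      using rv by auto
    have split: "(\<lambda>\<omega>. (f \<omega>, g \<omega>)) -` (X \<times> Y) \<inter> space M = (f -` X \<inter> space M) \<inter> (g -` Y \<inter> space M)"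
      for f g :: "'a \<Rightarrow> _ \<Rightarrow> 'c" and X Y
      by auto
    have "(\<Inter>j\<in>J. V j -` A j \<inter> W j -` B j \<inter> space M)
        = (\<Inter>j\<in>J. V j -` A j \<inter> space M) \<inter> (\<Inter>j\<in>J. W j -` B j \<inter> space M)"
      by blast
    also have "prob \<dots> = prob (\<Inter>j\<in>J. V j -` A j \<inter> space M) * prob (\<Inter>j\<in>J. W j -` B j \<inter> space M)"
      using indep_varD[OF VW cyl[of A] cyl[of B]] AB
      unfolding split pre[OF rvs(1)] pre[OF rvs(2)] by blast
    also have "\<dots> = (\<Prod>j\<in>J. prob (V j -` A j \<inter> space M)) * (\<Prod>j\<in>J. prob (W j -` B j \<inter> space M))"
      by (simp only: indep_varsD[OF V J(1,3,2) AB(1)] indep_varsD[OF W J(1,3,2) AB(2)])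
    finally show ?thesis .
  qed
  have "indep_sets E I"
  proof (rule indep_setsI)
    show "E i \<subseteq> events" if "i \<in> I" for i
    proof
      fix C assume "C \<in> E i"
      then obtain A B where "A \<in> sets N" "B \<in> sets N" "C = V i -` A \<inter> W i -` B \<inter> space M"
        by (auto simp: E_def)
      moreover have "V i -` A \<inter> W i -` B \<inter> space M = (V i -` A \<inter> space M) \<inter> (W i -` B \<inter> space M)"
        by blast
      ultimately show "C \<in> events"
        using rv[OF that] by (auto intro: measurable_sets)
    qed
    fix C J assume J: "J \<noteq> {}" "J \<subseteq> I" "finite J" and C: "\<forall>j\<in>J. C j \<in> E j"
    then have "\<forall>j\<in>J. \<exists>A B. C j = V j -` A \<inter> W j -` B \<inter> space M \<and> A \<in> sets N \<and> B \<in> sets N"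
      by (auto simp: E_def)
    then obtain A B where AB: "\<And>j. j \<in> J \<Longrightarrow> C j = V j -` A j \<inter> W j -` B j \<inter> space M"
      "\<And>j. j \<in> J \<Longrightarrow> A j \<in> sets N" "\<And>j. j \<in> J \<Longrightarrow> B j \<in> sets N"
      by metis
    have "prob (\<Inter>j\<in>J. C j) = (\<Prod>j\<in>J. prob (V j -` A j \<inter> space M) * prob (W j -` B j \<inter> space M))"
      using factor[OF J AB(2,3)] AB(1) by (simp add: prod.distrib)
    also have "\<dots> = (\<Prod>j\<in>J. prob (C j))"
    proof (rule prod.cong)
      fix j assume "j \<in> J"
      \<comment> \<open>The single-index instance of \<open>factor\<close>, read backwards,
        recombines the two marginal probabilities.\<close>
      then show "prob (V j -` A j \<inter> space M) * prob (W j -` B j \<inter> space M) = prob (C j)"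
        using factor[of "{j}" A B] AB J(2) by auto
    qed simp
    finally show "prob (\<Inter>j\<in>J. C j) = (\<Prod>j\<in>J. prob (C j))" .
  qed
  moreover have "Int_stable (E i)" for i
  proof (rule Int_stableI)
    fix a b assume "a \<in> E i" "b \<in> E i"
    then obtain A B A' B' where "a = V i -` A \<inter> W i -` B \<inter> space M" "b = V i -` A' \<inter> W i -` B' \<inter> space M"
      "A \<in> sets N" "B \<in> sets N" "A' \<in> sets N" "B' \<in> sets N"
      by (auto simp: E_def)
    then show "a \<inter> b \<in> E i"
      unfolding E_def by (intro CollectI exI[of _ "A \<inter> A'"] exI[of _ "B \<inter> B'"]) auto
  qed
  ultimately have indep: "indep_sets (\<lambda>i. sigma_sets (space M) (E i)) I"
    by (rule indep_sets_sigma)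
  show ?thesis
    unfolding indep_vars_def2
  proof (intro conjI ballI)
    show "random_variable (N \<Otimes>\<^sub>M N) (\<lambda>\<omega>. (V i \<omega>, W i \<omega>))" if "i \<in> I" for i
      using rv[OF that] by simp
    show "indep_sets (\<lambda>i. {(\<lambda>\<omega>. (V i \<omega>, W i \<omega>)) -` A \<inter> space M |A. A \<in> sets (N \<Otimes>\<^sub>M N)}) I"
    proof (rule indep_sets_mono_sets[OF indep])
      fix i assume i: "i \<in> I"
      have E: "E i \<subseteq> Pow (space M)"
        by (auto simp: E_def)
      have sp: "V i \<in> space M \<rightarrow> space N" "W i \<in> space M \<rightarrow> space N"
        using rv[OF i] by (auto simp: measurable_space)
      \<comment> \<open>Preimages under one coordinate are rectangles whose other side is the whole
        space.\<close>
      have "V i \<in> sigma (space M) (E i) \<rightarrow>\<^sub>M N"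
      proof (rule measurableI)
        fix A assume "A \<in> sets N"
        then have "V i -` A \<inter> W i -` space N \<inter> space M \<in> E i"
          unfolding E_def by blast
        moreover have "V i -` A \<inter> W i -` space N \<inter> space M = V i -` A \<inter> space M"
          using sp by auto
        ultimately show "V i -` A \<inter> space (sigma (space M) (E i)) \<in> sets (sigma (space M) (E i))"
          using E by auto
      qed (use sp E in auto)
      moreover have "W i \<in> sigma (space M) (E i) \<rightarrow>\<^sub>M N"
      proof (rule measurableI)
        fix B assume "B \<in> sets N"
        then have "V i -` space N \<inter> W i -` B \<inter> space M \<in> E i"
          unfolding E_def by blast
        moreover have "V i -` space N \<inter> W i -` B \<inter> space M = W i -` B \<inter> space M"
          using sp by auto
        ultimately show "W i -` B \<inter> space (sigma (space M) (E i)) \<in> sets (sigma (space M) (E i))"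
          using E by auto
      qed (use sp E in auto)
      ultimately have "(\<lambda>\<omega>. (V i \<omega>, W i \<omega>)) \<in> sigma (space M) (E i) \<rightarrow>\<^sub>M N \<Otimes>\<^sub>M N"
        by simp
      from measurable_sets[OF this]
      show "{(\<lambda>\<omega>. (V i \<omega>, W i \<omega>)) -` A \<inter> space M |A. A \<in> sets (N \<Otimes>\<^sub>M N)} \<subseteq> sigma_sets (space M) (E i)"
        using E by auto
    qed
  qed
qed

section \<open>Estimating the predicted passage time from the noisy walk\<close>

locale noisy_gaussian_walk = V: gaussian_sequence M V + W: gaussian_sequence M W
  for M :: "'a measure" and V W +
  assumes indep_VW: "prob_space.indep_var M
    (PiM {1..} (\<lambda>_. borel)) (\<lambda>\<omega>. \<lambda>i\<in>{1..}. V i \<omega>)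
    (PiM {1..} (\<lambda>_. borel)) (\<lambda>\<omega>. \<lambda>i\<in>{1..}. W i \<omega>)"
begin

lemma indep_functionals:
  assumes "f \<in> PiM {1..} (\<lambda>_. borel) \<rightarrow>\<^sub>M N" "g \<in> PiM {1..} (\<lambda>_. borel) \<rightarrow>\<^sub>M N'"
  shows "V.indep_var N (\<lambda>\<omega>. f (\<lambda>i\<in>{1..}. V i \<omega>)) N' (\<lambda>\<omega>. g (\<lambda>i\<in>{1..}. W i \<omega>))"
  using V.indep_var_compose[OF indep_VW assms] by (simp add: comp_def)

lemma distr_pair:
  assumes "1 \<le> i"
  shows "distr M (borel \<Otimes>\<^sub>M borel) (\<lambda>\<omega>. (V i \<omega>, W i \<omega>)) = std_gaussian_measure \<Otimes>\<^sub>M std_gaussian_measure"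
proof -
  have "V.indep_var borel (V i) borel (W i)"
    using indep_functionals[of "\<lambda>v. v i" borel "\<lambda>v. v i" borel] assms by simp
  then have "distr M (borel \<Otimes>\<^sub>M borel) (\<lambda>\<omega>. (V i \<omega>, W i \<omega>)) = distr M borel (V i) \<Otimes>\<^sub>M distr M borel (W i)"
    unfolding V.indep_var_distribution_eq by simp
  moreover have "distr M borel (V i) = std_gaussian_measure" "distr M borel (W i) = std_gaussian_measure"
    using V.std_normal[OF assms] W.std_normal[OF assms]
    by (auto simp: distributed_def cong: distr_cong)
  ultimately show ?thesis
    by simp
qed

text \<open>The pairs stay independent when each is reflected, and each keeps its law. The two
  sequences of pairs thus have the same product law, and every functional of the whole path has the
  same mean.\<close>

lemma reflection_invariance:
  fixes F :: "(nat \<Rightarrow> real \<times> real) \<Rightarrow> ennreal"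
  assumes "\<epsilon> \<noteq> 0" and F[measurable]: "F \<in> borel_measurable (PiM {1..} (\<lambda>_. borel \<Otimes>\<^sub>M borel))"
  shows "(\<integral>\<^sup>+\<omega>. F (\<lambda>i\<in>{1..}. reflect \<epsilon> (V i \<omega>, W i \<omega>)) \<partial>M) = (\<integral>\<^sup>+\<omega>. F (\<lambda>i\<in>{1..}. (V i \<omega>, W i \<omega>)) \<partial>M)"
proof -
  let ?B = "borel \<Otimes>\<^sub>M borel :: (real \<times> real) measure"
  let ?P = "\<lambda>i \<omega>. (V i \<omega>, W i \<omega>)"
  have P: "V.indep_vars (\<lambda>_. ?B) ?P {1..}"
    by (rule V.indep_vars_Pair[OF V.indep W.indep indep_VW])
  have P': "V.indep_vars (\<lambda>_. ?B) (\<lambda>i \<omega>. reflect \<epsilon> (?P i \<omega>)) {1..}"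
    by (rule V.indep_vars_compose2[OF P]) simp
  have rv[measurable]: "?P i \<in> M \<rightarrow>\<^sub>M ?B" if "i \<in> {1..}" for i
    using P that by (simp add: V.indep_vars_def2)
  have rv'[measurable]: "(\<lambda>\<omega>. reflect \<epsilon> (?P i \<omega>)) \<in> M \<rightarrow>\<^sub>M ?B" if "i \<in> {1..}" for i
    using P' that by (simp add: V.indep_vars_def2)
  have "distr M ?B (\<lambda>\<omega>. reflect \<epsilon> (?P i \<omega>)) = distr M ?B (?P i)" if "i \<in> {1..}" for i
  proof -
    have "distr M ?B (\<lambda>\<omega>. reflect \<epsilon> (?P i \<omega>)) = distr (distr M ?B (?P i)) ?B (reflect \<epsilon>)"
      using rv[OF that] by (subst distr_distr) (auto simp: comp_def)
    also have "\<dots> = distr M ?B (?P i)"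
      using that by (simp only: distr_pair atLeast_iff distr_std_gaussian_pair_reflect[OF assms(1)])
    finally show ?thesis .
  qed
  then have "PiM {1..} (\<lambda>i. distr M ?B (\<lambda>\<omega>. reflect \<epsilon> (?P i \<omega>))) = PiM {1..} (\<lambda>i. distr M ?B (?P i))"
    by (intro PiM_cong) auto
  then have eq: "distr M (PiM {1..} (\<lambda>_. ?B)) (\<lambda>\<omega>. \<lambda>i\<in>{1..}. reflect \<epsilon> (?P i \<omega>))
      = distr M (PiM {1..} (\<lambda>_. ?B)) (\<lambda>\<omega>. \<lambda>i\<in>{1..}. ?P i \<omega>)"
    using V.indep_vars_iff_distr_eq_PiM'[of "{1..}" "\<lambda>i \<omega>. reflect \<epsilon> (?P i \<omega>)" "\<lambda>_. ?B"]
      V.indep_vars_iff_distr_eq_PiM'[of "{1..}" ?P "\<lambda>_. ?B"] P P' rv rv' by simp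
  have m: "(\<lambda>\<omega>. \<lambda>i\<in>{1..}. reflect \<epsilon> (?P i \<omega>)) \<in> M \<rightarrow>\<^sub>M PiM {1..} (\<lambda>_. ?B)"
    "(\<lambda>\<omega>. \<lambda>i\<in>{1..}. ?P i \<omega>) \<in> M \<rightarrow>\<^sub>M PiM {1..} (\<lambda>_. ?B)"
    by (rule measurable_restrict, erule rv', rule measurable_restrict, erule rv)
  have "(\<integral>\<^sup>+\<omega>. F (\<lambda>i\<in>{1..}. reflect \<epsilon> (?P i \<omega>)) \<partial>M)
      = (\<integral>\<^sup>+p. F p \<partial>distr M (PiM {1..} (\<lambda>_. ?B)) (\<lambda>\<omega>. \<lambda>i\<in>{1..}. reflect \<epsilon> (?P i \<omega>)))"
    by (subst nn_integral_distr[OF m(1)]) (use F in simp_all)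
  also have "\<dots> = (\<integral>\<^sup>+\<omega>. F (\<lambda>i\<in>{1..}. ?P i \<omega>) \<partial>M)"
    unfolding eq by (subst nn_integral_distr[OF m(2)]) (use F in simp_all)
  finally show ?thesis .
qed

lemma noise_difference_normal:
  assumes "1 \<le> n" "0 < \<epsilon>"
  shows "distributed M lborel (\<lambda>\<omega>. \<epsilon> * (\<Sum>i=1..n. V i \<omega>) - (\<Sum>i=1..n. W i \<omega>))
    (normal_density 0 (sqrt ((1 + \<epsilon>\<^sup>2) * real n)))"
proof -
  let ?SV = "\<lambda>\<omega>. \<epsilon> * (\<Sum>i=1..n. V i \<omega>)" and ?SW = "\<lambda>\<omega>. \<Sum>i=1..n. W i \<omega>"
  have "V.indep_var borel ?SV borel ?SW"
    using indep_functionals[of "\<lambda>v. \<epsilon> * (\<Sum>i=1..n. v i)" borel "\<lambda>v. \<Sum>i=1..n. v i" borel]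
    by simp
  moreover have "distributed M lborel ?SV (normal_density 0 (\<epsilon> * sqrt (real n)))"
    using V.normal_density_affine[OF V.sum_normal[OF assms(1)], of \<epsilon> 0] assms by simp
  moreover have "distributed M lborel ?SW (normal_density 0 (sqrt (real n)))"
    by (rule W.sum_normal[OF assms(1)])
  ultimately have "distributed M lborel (\<lambda>\<omega>. ?SV \<omega> - ?SW \<omega>)
      (normal_density (0 - 0) (sqrt ((\<epsilon> * sqrt (real n))\<^sup>2 + (sqrt (real n))\<^sup>2)))"
    using assms by (intro V.diff_indep_normal) auto
  moreover have "(\<epsilon> * sqrt (real n))\<^sup>2 + (sqrt (real n))\<^sup>2 = (1 + \<epsilon>\<^sup>2) * real n"
    by (simp add: power_mult_distrib algebra_simps)
  ultimately show ?thesis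
    by simp
qed

text \<open>Reflection leaves the observations, and so the estimate, unchanged, but shifts the
  target by \<open>k / s * D\<close>. By the triangle inequality the two errors sum to at least the
  size of the shift; they have equal means, so each mean is at least half the mean shift.\<close>

lemma estimation_error_ge:
  assumes \<eta>: "\<eta> \<in> estimators" and pos: "0 < \<epsilon>" "0 < s" "1 \<le> n"
  shows "ennreal (sqrt (2 * real n * \<epsilon>\<^sup>2 / (pi * s\<^sup>2 * (1 + \<epsilon>\<^sup>2))))
    \<le> (\<integral>\<^sup>+\<omega>. ennreal \<bar>\<eta> (\<lambda>t. noisy_walk s \<epsilon> V W t \<omega>) - (real n + (l - drift_walk s V n \<omega>) / s)\<bar> \<partial>M)"
proof -
  let ?B = "borel \<Otimes>\<^sub>M borel :: (real \<times> real) measure"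
  let ?P = "\<lambda>\<omega>. \<lambda>i\<in>{1..}. (V i \<omega>, W i \<omega>)" and ?P' = "\<lambda>\<omega>. \<lambda>i\<in>{1..}. reflect \<epsilon> (V i \<omega>, W i \<omega>)"
  \<comment> \<open>The walks are written as functionals of the path of pairs, so that both the
    original and the reflected path can be inserted.\<close>
  define X where "X = drift_walk s (\<lambda>i p. fst (p i :: real \<times> real))"
  define Y where "Y = noisy_walk s \<epsilon> (\<lambda>i p. fst (p i :: real \<times> real)) (\<lambda>i p. snd (p i))"
  define F where "F p = ennreal \<bar>\<eta> (\<lambda>t. Y t p) - (real n + (l - X n p) / s)\<bar>" for p
  define D where "D \<omega> = \<epsilon> * (\<Sum>i=1..n. V i \<omega>) - (\<Sum>i=1..n. W i \<omega>)" for \<omega>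
  define k where "k = 2 * \<epsilon> / (1 + \<epsilon>\<^sup>2)"
  have \<epsilon>2: "0 < 1 + \<epsilon>\<^sup>2"
    by (simp add: add_pos_nonneg)
  then have k: "0 < k"
    using pos by (simp add: k_def)
  have meas_fst: "(\<lambda>p. fst (p i)) \<in> borel_measurable (PiM {1..} (\<lambda>_. ?B))"
    and meas_snd: "(\<lambda>p. snd (p i)) \<in> borel_measurable (PiM {1..} (\<lambda>_. ?B))" if "1 \<le> i" for i
    using that by (auto intro!: measurable_compose[OF measurable_component_singleton])
  have X: "X t \<in> borel_measurable (PiM {1..} (\<lambda>_. ?B))" for t
    unfolding X_def by (rule drift_walk_measurable) (rule meas_fst)
  have Y: "Y t \<in> borel_measurable (PiM {1..} (\<lambda>_. ?B))" for t
  proof -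
    have "(\<lambda>p. \<Sum>i=1..t. snd (p i)) \<in> borel_measurable (PiM {1..} (\<lambda>_. ?B))"
      by (rule borel_measurable_sum) (rule meas_snd, simp)
    then have "(\<lambda>p. X t p + \<epsilon> * (\<Sum>i=1..t. snd (p i))) \<in> borel_measurable (PiM {1..} (\<lambda>_. ?B))"
      by (rule borel_measurable_add[OF X borel_measurable_times[OF borel_measurable_const]])
    moreover have "Y t = (\<lambda>p. X t p + \<epsilon> * (\<Sum>i=1..t. snd (p i)))"
      unfolding Y_def X_def by (rule ext) (rule noisy_walk_def)
    ultimately show ?thesis
      by simp
  qed
  have [measurable]: "\<eta> \<in> borel_measurable (PiM UNIV (\<lambda>_. borel))"
    using \<eta> by (simp add: estimators_def)
  have F: "F \<in> borel_measurable (PiM {1..} (\<lambda>_. ?B))"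
  proof -
    have "(\<lambda>p. \<lambda>t\<in>UNIV. Y t p) \<in> PiM {1..} (\<lambda>_. ?B) \<rightarrow>\<^sub>M PiM UNIV (\<lambda>_. borel)"
      by (rule measurable_restrict) (rule Y)
    then have 1: "(\<lambda>p. \<eta> (\<lambda>t. Y t p)) \<in> borel_measurable (PiM {1..} (\<lambda>_. ?B))"
      unfolding restrict_UNIV by (rule measurable_compose) simp
    have 2: "(\<lambda>p. real n + (l - X n p) / s) \<in> borel_measurable (PiM {1..} (\<lambda>_. ?B))"
      by (intro borel_measurable_add borel_measurable_divide borel_measurable_diff borel_measurable_const X)
    show ?thesis
      unfolding F_def[abs_def]
      by (rule measurable_compose[OF borel_measurable_abs[OF borel_measurable_diff[OF 1 2]] measurable_ennreal])
  qed
  have [measurable]: "(\<lambda>\<omega>. (V i \<omega>, W i \<omega>)) \<in> M \<rightarrow>\<^sub>M ?B" if "1 \<le> i" for i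
    using V.measurable_V[OF that] W.measurable_V[OF that] by simp
  have P[measurable]: "?P \<in> M \<rightarrow>\<^sub>M PiM {1..} (\<lambda>_. ?B)" "?P' \<in> M \<rightarrow>\<^sub>M PiM {1..} (\<lambda>_. ?B)"
    by (intro measurable_restrict measurable_compose[OF _ measurable_reflect]; simp)+
  have Y_P: "Y t (?P \<omega>) = noisy_walk s \<epsilon> V W t \<omega>" for t \<omega>
    unfolding Y_def noisy_walk_def drift_walk_def by (auto intro!: sum.cong arg_cong2[of _ _ _ _ "(+)"])
  have X_P: "X t (?P \<omega>) = drift_walk s V t \<omega>" for t \<omega>
    unfolding X_def drift_walk_def by (auto intro!: sum.cong)
  \<comment> \<open>The observations depend on the pairs only through the combination that
    reflection preserves.\<close>
  have Y_alt: "Y t p = (\<Sum>i=1..t. fst (p i) + \<epsilon> * snd (p i)) + s * real t" for t p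
    by (simp add: Y_def noisy_walk_def drift_walk_def sum.distrib sum_distrib_left)
  have Y_P': "Y t (?P' \<omega>) = Y t (?P \<omega>)" for t \<omega>
    unfolding Y_alt by (auto intro!: sum.cong simp: reflect_observation)
  have X_P': "X n (?P' \<omega>) = X n (?P \<omega>) - k * D \<omega>" for \<omega>
  proof -
    have "(\<Sum>i=1..n. fst (?P' \<omega> i)) = (\<Sum>i=1..n. V i \<omega> - k * (\<epsilon> * V i \<omega> - W i \<omega>))"
      by (intro sum.cong) (auto simp: fst_reflect k_def)
    also have "\<dots> = (\<Sum>i=1..n. V i \<omega>) - k * D \<omega>"
      by (simp add: D_def sum_subtractf flip: sum_distrib_left)
    finally show ?thesis
      unfolding X_P by (simp add: X_def drift_walk_def)
  qed
  let ?I = "\<integral>\<^sup>+\<omega>. F (?P \<omega>) \<partial>M"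
  have D: "integrable M D" "V.expectation (\<lambda>\<omega>. \<bar>D \<omega>\<bar>) = sqrt ((1 + \<epsilon>\<^sup>2) * real n) * sqrt (2 / pi)"
    using V.normal_moments[OF noise_difference_normal[OF pos(3,1)]] \<epsilon>2 pos(3) by (simp_all add: D_def[abs_def])
  have "ennreal (k / s * (sqrt ((1 + \<epsilon>\<^sup>2) * real n) * sqrt (2 / pi))) = (\<integral>\<^sup>+\<omega>. ennreal (k / s * \<bar>D \<omega>\<bar>) \<partial>M)"
    using D k pos by (subst nn_integral_eq_integral) auto
  also have "\<dots> \<le> (\<integral>\<^sup>+\<omega>. F (?P \<omega>) + F (?P' \<omega>) \<partial>M)"
  proof (rule nn_integral_mono)
    fix \<omega>
    let ?y = "\<eta> (\<lambda>t. Y t (?P \<omega>))" and ?x = "real n + (l - X n (?P \<omega>)) / s"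
    have "real n + (l - X n (?P' \<omega>)) / s = ?x + k / s * D \<omega>"
      unfolding X_P' using pos by (simp add: field_simps)
    then have "F (?P' \<omega>) = ennreal \<bar>?y - (?x + k / s * D \<omega>)\<bar>"
      by (simp only: F_def Y_P')
    moreover have "\<bar>z\<bar> \<le> \<bar>?y - ?x\<bar> + \<bar>?y - (?x + z)\<bar>" for z
      by arith
    from this[of "k / s * D \<omega>"] have "k / s * \<bar>D \<omega>\<bar> \<le> \<bar>?y - ?x\<bar> + \<bar>?y - (?x + k / s * D \<omega>)\<bar>"
      using k pos by (simp add: abs_mult)
    ultimately show "ennreal (k / s * \<bar>D \<omega>\<bar>) \<le> F (?P \<omega>) + F (?P' \<omega>)"
      by (simp add: F_def ennreal_plus[symmetric] ennreal_leI del: ennreal_plus)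
  qed
  also have "\<dots> = ?I + (\<integral>\<^sup>+\<omega>. F (?P' \<omega>) \<partial>M)"
    by (rule nn_integral_add) (rule measurable_compose[OF P(1) F], rule measurable_compose[OF P(2) F])
  also have "(\<integral>\<^sup>+\<omega>. F (?P' \<omega>) \<partial>M) = ?I"
    using pos by (intro reflection_invariance F) auto
  finally have le: "ennreal (k / s * (sqrt ((1 + \<epsilon>\<^sup>2) * real n) * sqrt (2 / pi))) \<le> 2 * ?I"
    by (simp only: mult_2)
  \<comment> \<open>The mean shift is exactly twice the claimed bound: one factor
    \<open>sqrt (1 + \<epsilon>\<^sup>2)\<close> from the deviation of \<open>D\<close> cancels
    against the denominator of \<open>k\<close>.\<close>
  have "k / s * (sqrt ((1 + \<epsilon>\<^sup>2) * real n) * sqrt (2 / pi)) = 2 * sqrt (2 * real n * \<epsilon>\<^sup>2 / (pi * s\<^sup>2 * (1 + \<epsilon>\<^sup>2)))"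
  proof -
    have "sqrt (2 * real n * \<epsilon>\<^sup>2 / (pi * s\<^sup>2 * e)) = \<epsilon> / (s * e) * (sqrt (e * real n) * sqrt (2 / pi))"
      if "0 < e" for e
      using pos that
      by (intro real_sqrt_unique) (simp_all add: power_mult_distrib power_divide field_simps power2_eq_square)
    from this[OF \<epsilon>2] show ?thesis
      by (simp add: k_def mult_ac)
  qed
  then have "2 * ennreal (sqrt (2 * real n * \<epsilon>\<^sup>2 / (pi * s\<^sup>2 * (1 + \<epsilon>\<^sup>2)))) \<le> 2 * ?I"
    using le by (simp add: ennreal_mult')
  then have "ennreal (sqrt (2 * real n * \<epsilon>\<^sup>2 / (pi * s\<^sup>2 * (1 + \<epsilon>\<^sup>2)))) \<le> ?I"
    by (simp add: ennreal_mult_le_mult_iff)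
  then show ?thesis
    by (simp only: F_def Y_P X_P)
qed

section \<open>Combining the estimation and prediction errors\<close>

lemma tracking_error_le:
  fixes l s :: real and n :: nat
  defines "r \<equiv> 2 + 6 / s + sqrt (2 * (max 0 (l - s * real n) + sqrt (real n / (2 * pi))) / (pi * s ^ 3))
      + (sqrt (real n) * l + real n) / s * sqrt (gaussian_Q ((l - s * real n) / sqrt (real n)))"
  assumes "0 < s" "0 < l" "1 \<le> n" "s * real n < l"
  shows "0 \<le> r"
    "(\<integral>\<^sup>+\<omega>. e2ennreal \<bar>ereal (real n + (l - drift_walk s V n \<omega>) / s) - first_passage (drift_walk s V) l \<omega>\<bar> \<partial>M) \<le> ennreal r"
proof -
  let ?X = "drift_walk s V"
  let ?e = "\<lambda>\<omega>. e2ennreal \<bar>ereal (real n + (l - ?X n \<omega>) / s) - first_passage ?X l \<omega>\<bar>"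
  let ?a = "2 + 6 / s + sqrt (2 * (max 0 (l - s * real n) + sqrt (real n / (2 * pi))) / (pi * s ^ 3))"
  let ?b = "(sqrt (real n) * l + real n) / s * sqrt (gaussian_Q ((l - s * real n) / sqrt (real n)))"
  have ab: "0 \<le> ?a" "0 \<le> ?b"
    using assms(2,3) gaussian_Q_nonneg by (auto intro!: add_nonneg_nonneg mult_nonneg_nonneg divide_nonneg_nonneg)
  then show "0 \<le> r"
    unfolding r_def by (rule add_nonneg_nonneg)
  have fp[measurable]: "(\<lambda>\<omega>. first_passage ?X l \<omega>) \<in> borel_measurable M"
    by (rule borel_measurable_first_passage) auto
  have e: "?e \<in> borel_measurable M"
    by measurable
  have I: "(indicator (stays_below ?X l n) :: 'a \<Rightarrow> ennreal) \<in> borel_measurable M"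
    by measurable
  have I': "(indicator (- stays_below ?X l n) :: 'a \<Rightarrow> ennreal) \<in> borel_measurable M"
    unfolding indicator_def Compl_iff by measurable
  have "(\<integral>\<^sup>+\<omega>. ?e \<omega> \<partial>M) = (\<integral>\<^sup>+\<omega>. ?e \<omega> * indicator (stays_below ?X l n) \<omega> + ?e \<omega> * indicator (- stays_below ?X l n) \<omega> \<partial>M)"
    by (intro nn_integral_cong) (simp split: split_indicator)
  also have "\<dots> = (\<integral>\<^sup>+\<omega>. ?e \<omega> * indicator (stays_below ?X l n) \<omega> \<partial>M) + (\<integral>\<^sup>+\<omega>. ?e \<omega> * indicator (- stays_below ?X l n) \<omega> \<partial>M)"
    using e I I' by (intro nn_integral_add borel_measurable_times_ennreal)
  also have "\<dots> \<le> ennreal ?a + ennreal ?b"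
    using assms by (intro add_mono V.late_passage_error V.early_passage_error)
  also have "\<dots> = ennreal r"
    unfolding r_def using ab by (rule ennreal_plus[symmetric])
  finally show "(\<integral>\<^sup>+\<omega>. ?e \<omega> \<partial>M) \<le> ennreal r" .
qed

text \<open>The predicted time serves as an intermediate target: an estimator close to the passage
  time would also be close to the prediction, up to the mean prediction error
  \<open>r\<close>.\<close>

lemma mean_abs_error_ge:
  fixes l s :: real and n :: nat
  defines "r \<equiv> 2 + 6 / s + sqrt (2 * (max 0 (l - s * real n) + sqrt (real n / (2 * pi))) / (pi * s ^ 3))
      + (sqrt (real n) * l + real n) / s * sqrt (gaussian_Q ((l - s * real n) / sqrt (real n)))"
  assumes \<eta>: "\<eta> \<in> estimators" and pos: "0 < \<epsilon>" "0 < s" "0 < l" "1 \<le> n" "s * real n < l"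
  shows "ennreal (sqrt (2 * real n * \<epsilon>\<^sup>2 / (pi * s\<^sup>2 * (1 + \<epsilon>\<^sup>2))) - r)
    \<le> mean_abs_error M (noisy_walk s \<epsilon> V W) (first_passage (drift_walk s V) l) \<eta>"
proof -
  let ?X = "drift_walk s V"
  let ?\<xi> = "\<lambda>\<omega>. real n + (l - ?X n \<omega>) / s"
  let ?\<tau> = "\<lambda>\<omega>. first_passage ?X l \<omega>"
  let ?h = "\<lambda>\<omega>. \<eta> (\<lambda>t. noisy_walk s \<epsilon> V W t \<omega>)"
  let ?A = "sqrt (2 * real n * \<epsilon>\<^sup>2 / (pi * s\<^sup>2 * (1 + \<epsilon>\<^sup>2)))"
  have r: "0 \<le> r" and err: "(\<integral>\<^sup>+\<omega>. e2ennreal \<bar>ereal (?\<xi> \<omega>) - ?\<tau> \<omega>\<bar> \<partial>M) \<le> ennreal r"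
    unfolding r_def using tracking_error_le[OF pos(2-5)] by auto
  \<comment> \<open>The triangle inequality also covers an infinite passage time, for which the
    right side is infinite.\<close>
  have tri: "ennreal \<bar>a - b\<bar> \<le> e2ennreal \<bar>ereal a - c\<bar> + e2ennreal \<bar>ereal b - c\<bar>" for a b c
    by (cases c) (auto simp: e2ennreal_ereal e2ennreal_infty ennreal_plus[symmetric] intro!: ennreal_leI simp del: ennreal_plus)
  have fp[measurable]: "(\<lambda>\<omega>. ?\<tau> \<omega>) \<in> borel_measurable M"
    by (rule borel_measurable_first_passage) auto
  have Y: "noisy_walk s \<epsilon> V W t \<in> borel_measurable M" for t
  proof -
    have "(\<lambda>\<omega>. \<Sum>i=1..t. W i \<omega>) \<in> borel_measurable M"
      by (rule borel_measurable_sum) (rule W.measurable_V, simp)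
    then have "(\<lambda>\<omega>. ?X t \<omega> + \<epsilon> * (\<Sum>i=1..t. W i \<omega>)) \<in> borel_measurable M"
      by (rule borel_measurable_add[OF V.measurable_walk borel_measurable_times[OF borel_measurable_const]])
    then show ?thesis
      by (simp add: noisy_walk_def[abs_def])
  qed
  have h[measurable]: "?h \<in> borel_measurable M"
  proof -
    have "(\<lambda>\<omega>. \<lambda>t\<in>UNIV. noisy_walk s \<epsilon> V W t \<omega>) \<in> M \<rightarrow>\<^sub>M PiM UNIV (\<lambda>_. borel)"
      by (rule measurable_restrict) (rule Y)
    then show ?thesis
      using \<eta> unfolding restrict_UNIV estimators_def by (rule measurable_compose)
  qed
  have "ennreal ?A \<le> (\<integral>\<^sup>+\<omega>. ennreal \<bar>?h \<omega> - ?\<xi> \<omega>\<bar> \<partial>M)"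
    using \<eta> pos by (intro estimation_error_ge)
  also have "\<dots> \<le> (\<integral>\<^sup>+\<omega>. e2ennreal \<bar>ereal (?h \<omega>) - ?\<tau> \<omega>\<bar> + e2ennreal \<bar>ereal (?\<xi> \<omega>) - ?\<tau> \<omega>\<bar> \<partial>M)"
    by (intro nn_integral_mono tri)
  also have "\<dots> = mean_abs_error M (noisy_walk s \<epsilon> V W) ?\<tau> \<eta> + (\<integral>\<^sup>+\<omega>. e2ennreal \<bar>ereal (?\<xi> \<omega>) - ?\<tau> \<omega>\<bar> \<partial>M)"
    unfolding mean_abs_error_def by (rule nn_integral_add) measurable
  also have "\<dots> \<le> mean_abs_error M (noisy_walk s \<epsilon> V W) ?\<tau> \<eta> + ennreal r"
    by (intro add_left_mono err)
  \<comment> \<open>Moving the finite \<open>r\<close> across is a truncated subtraction; when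
    \<open>r\<close> exceeds the leading term, the lower bound is 0.\<close>
  finally show ?thesis
    using r by (simp add: ennreal_minus[symmetric] ennreal_minus_le_iff add.commute)
qed

end

lemma powr_quarter: "0 \<le> x \<Longrightarrow> x powr (1 / 4) = sqrt (sqrt x)"
  by (simp add: powr_half_sqrt[symmetric] powr_powr)

theorem theorem2p2:
  fixes M :: "'a measure"
    and V W :: "nat \<Rightarrow> 'a \<Rightarrow> real"
    and \<epsilon> s l :: real
    and n :: nat
  assumes "prob_space M"
    and "0 < \<epsilon>" and "0 < s" and "0 < l"
    and "\<And>i. i \<ge> 1 \<Longrightarrow> distributed M lborel (V i) std_normal_density"
    and "\<And>i. i \<ge> 1 \<Longrightarrow> distributed M lborel (W i) std_normal_density"
    and "prob_space.indep_vars M (\<lambda>_. borel) V {1..}"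
    and "prob_space.indep_vars M (\<lambda>_. borel) W {1..}"
    and "prob_space.indep_var M
           (PiM {1..} (\<lambda>_. borel)) (\<lambda>\<omega>. \<lambda>i\<in>{1..}. V i \<omega>)
           (PiM {1..} (\<lambda>_. borel)) (\<lambda>\<omega>. \<lambda>i\<in>{1..}. W i \<omega>)"
    and "1 \<le> n" and "real n < l / s"
  shows "enn2ereal (INF \<eta>\<in>estimators.
            mean_abs_error M (noisy_walk s \<epsilon> V W) (first_passage (drift_walk s V) l) \<eta>)
         \<ge> ereal (sqrt (2 * real n * \<epsilon>\<^sup>2 / (pi * s\<^sup>2 * (1 + \<epsilon>\<^sup>2)))
             - (2 * real n / (pi ^ 3 * s ^ 6)) powr (1 / 4)
             - sqrt (2 * max 0 (l - s * real n) / (pi * s ^ 3))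
             - 2 - 6 / s
             - (2 * real n powr (3 / 2) + real n / s + real n powr (1 / 2) * l / s)
                 * sqrt (gaussian_Q ((l - s * real n) / sqrt (real n))))"
proof -
  interpret prob_space M by fact
  interpret noisy_gaussian_walk M V W
    using assms by unfold_locales auto
  let ?A = "sqrt (2 * real n * \<epsilon>\<^sup>2 / (pi * s\<^sup>2 * (1 + \<epsilon>\<^sup>2)))"
  let ?B = "(2 * real n / (pi ^ 3 * s ^ 6)) powr (1 / 4)"
  let ?C = "sqrt (2 * max 0 (l - s * real n) / (pi * s ^ 3))"
  let ?Q = "sqrt (gaussian_Q ((l - s * real n) / sqrt (real n)))"
  let ?D = "(2 * real n powr (3 / 2) + real n / s + real n powr (1 / 2) * l / s) * ?Q"
  define r where "r = 2 + 6 / s + sqrt (2 * (max 0 (l - s * real n) + sqrt (real n / (2 * pi))) / (pi * s ^ 3))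
      + (sqrt (real n) * l + real n) / s * ?Q"
  have sn: "s * real n < l"
    using assms(3,11) by (simp add: pos_less_divide_eq mult.commute)
  have "ennreal (?A - r) \<le> (INF \<eta>\<in>estimators. mean_abs_error M (noisy_walk s \<epsilon> V W) (first_passage (drift_walk s V) l) \<eta>)"
    unfolding r_def using assms(2-4,10) sn by (intro INF_greatest mean_abs_error_ge)
  then have "enn2ereal (ennreal (?A - r)) \<le> enn2ereal (INF \<eta>\<in>estimators. mean_abs_error M (noisy_walk s \<epsilon> V W) (first_passage (drift_walk s V) l) \<eta>)"
    by (simp only: less_eq_ennreal.rep_eq)
  \<comment> \<open>A negative real becomes 0 in \<open>ennreal\<close>, so converting back to
    extended reals never lowers the bound.\<close>
  moreover have "ereal x \<le> enn2ereal (ennreal x)" for x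
    by (cases "0 \<le> x") (auto simp: enn2ereal_ennreal ennreal_neg zero_ennreal.rep_eq)
  moreover have "r \<le> 2 + 6 / s + ?B + ?C + ?D"
  proof -
    have "sqrt (2 * (max 0 (l - s * real n) + sqrt (real n / (2 * pi))) / (pi * s ^ 3))
        = sqrt (2 * max 0 (l - s * real n) / (pi * s ^ 3) + 2 * sqrt (real n / (2 * pi)) / (pi * s ^ 3))"
      by (simp add: add_divide_distrib distrib_left)
    \<comment> \<open>Subadditivity of the root separates the distance from the mean position at
      time \<open>n\<close> from the fluctuation of the walk. The latter is already a square root,
      whence the fourth root in \<open>?B\<close>.\<close>
    also have "\<dots> \<le> ?C + sqrt (2 * sqrt (real n / (2 * pi)) / (pi * s ^ 3))"
      using assms(3) by (intro sqrt_add_le_add_sqrt) auto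
    also have "2 * sqrt (real n / (2 * pi)) / (pi * s ^ 3) = sqrt (2 * real n / (pi ^ 3 * s ^ 6))"
      using assms(3)
      by (intro real_sqrt_unique[symmetric])
         (simp_all add: power_mult_distrib power_divide field_simps power2_eq_square power3_eq_cube eval_nat_numeral)
    also have "sqrt (sqrt (2 * real n / (pi ^ 3 * s ^ 6))) = ?B"
      using assms(3) by (intro powr_quarter[symmetric]) simp
    finally have 1: "sqrt (2 * (max 0 (l - s * real n) + sqrt (real n / (2 * pi))) / (pi * s ^ 3)) \<le> ?C + ?B" .
    \<comment> \<open>The early-passage term falls short of \<open>?D\<close> by the nonnegative
      amount \<open>2 * real n powr (3 / 2) * ?Q\<close>.\<close>
    have "(sqrt (real n) * l + real n) / s = real n / s + real n powr (1 / 2) * l / s"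
      by (simp add: powr_half_sqrt add_divide_distrib)
    then have "(sqrt (real n) * l + real n) / s * ?Q \<le> ?D"
      by (intro mult_right_mono) (simp_all add: gaussian_Q_nonneg)
    with 1 show ?thesis
      unfolding r_def by linarith
  qed
  then have "?A - ?B - ?C - 2 - 6 / s - ?D \<le> ?A - r"
    by linarith
  ultimately show ?thesis
    by (meson ereal_less_eq(3) order_trans)
qed

end
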